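(* For any $n\ge 2$, the $\mathbb{Z}$-algebra $\mathbf{H}(S_n)$ is a Hopf algebra over $\mathbb{Z}$ with the coproduct $\Delta$, the counit $\varepsilon$, and the antipode anti-automorphism $S$ given respectively by (for $i=1,\ldots,n-1$): $$\Delta(s_i)=s_i\otimes s_i,\quad \Delta(D_i)=D_i\otimes 1+s_i\otimes D_i,\quad \varepsilon(s_i)=1,\quad \varepsilon(D_i)=0,\quad S(s_i)=s_i,\quad S(D_i)=-s_iD_i.$$
   Context: For $n\ge 2$, $\mathbf{H}(S_n)$ denotes the (unital associative) $\mathbb{Z}$-algebra generated by $s_i$ and $D_i$, $i=1,\ldots,n-1$, subject to the relations: (1) $s_i^2=1$, $s_iD_i+D_is_i=s_i-1$, $D_i^2=D_i$ for $i=1,\ldots,n-1$; (2) $s_js_i=s_is_j$, $D_js_i=s_iD_j$, $D_jD_i=D_iD_j$ if $|i-j|>1$; (3) $s_js_is_j=s_is_js_i$, $D_is_js_i=s_js_iD_j$, $D_js_iD_j=s_iD_jD_i+D_iD_js_i+s_iD_js_i$ if $|i-j|=1$. *)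

theory Defs
  imports "HOL-Algebra.Free_Abelian_Groups" "HOL-Algebra.QuotRing" "HOL-Algebra.IntRing"
begin

section \<open>Integral monoid rings and free rings\<close>

text \<open>The ring \<open>\<int>[M]\<close>: finitely supported functions \<open>M \<rightarrow> \<int>\<close>, with the bilinear extension of the
  multiplication of \<open>M\<close> (\<^const>\<open>frag_extend\<close> is the linear extension of a map on basis elements).\<close>

definition int_monoid_ring :: "('a, 'm) monoid_scheme \<Rightarrow> ('a \<Rightarrow>\<^sub>0 int) ring" where
  "int_monoid_ring M =
    \<lparr>carrier = {p. Poly_Mapping.keys p \<subseteq> carrier M},
     monoid.mult = (\<lambda>p q. frag_extend (\<lambda>a. frag_extend (\<lambda>b. frag_of (a \<otimes>\<^bsub>M\<^esub> b)) q) p),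
     one = frag_of \<one>\<^bsub>M\<^esub>, ring.zero = 0, add = (+)\<rparr>"

definition free_monoid :: "'g set \<Rightarrow> 'g list monoid" where
  "free_monoid V = \<lparr>carrier = lists V, monoid.mult = (@), one = []\<rparr>"

text \<open>The free unital associative \<open>\<int>\<close>-algebra \<open>\<int>\<langle>V\<rangle>\<close>. Throughout, a \<open>\<int>\<close>-algebra is a (unital,
  associative) ring, and \<open>\<int>\<close>-linear means additive.\<close>

definition free_ring :: "'g set \<Rightarrow> ('g list \<Rightarrow>\<^sub>0 int) ring" where
  "free_ring V = int_monoid_ring (free_monoid V)"

definition free_gen :: "'g \<Rightarrow> 'g list \<Rightarrow>\<^sub>0 int" where
  "free_gen x = frag_of [x]"


section \<open>Tensor products over the integers\<close>

text \<open>\<open>A \<otimes> B\<close> is the quotient of the free abelian group on \<open>A \<times> B\<close> by the subgroup generated by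
  the biadditivity relations (over \<open>\<int>\<close> these imply the balancing relations). The multiplication
  \<open>(a \<otimes> b)(c \<otimes> d) = ac \<otimes> bd\<close> is the one induced by the monoid ring of \<open>A \<times> B\<close>.\<close>

definition biadditive_rels ::
  "('a, 'm) ring_scheme \<Rightarrow> ('b, 'n) ring_scheme \<Rightarrow> ('a \<times> 'b \<Rightarrow>\<^sub>0 int) set" where
  "biadditive_rels A B =
    {frag_of (a \<oplus>\<^bsub>A\<^esub> a', b) - frag_of (a, b) - frag_of (a', b) | a a' b.
       a \<in> carrier A \<and> a' \<in> carrier A \<and> b \<in> carrier B} \<union>
    {frag_of (a, b \<oplus>\<^bsub>B\<^esub> b') - frag_of (a, b) - frag_of (a, b') | a b b'.
       a \<in> carrier A \<and> b \<in> carrier B \<and> b' \<in> carrier B}"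

definition tensor_kernel ::
  "('a, 'm) ring_scheme \<Rightarrow> ('b, 'n) ring_scheme \<Rightarrow> ('a \<times> 'b \<Rightarrow>\<^sub>0 int) set" where
  "tensor_kernel A B =
    generate (add_monoid (int_monoid_ring (A \<times>\<times> B))) (biadditive_rels A B)"

definition tensor_ring ::
  "('a, 'm) ring_scheme \<Rightarrow> ('b, 'n) ring_scheme \<Rightarrow> ('a \<times> 'b \<Rightarrow>\<^sub>0 int) set ring" where
  "tensor_ring A B = int_monoid_ring (A \<times>\<times> B) Quot tensor_kernel A B"

definition pure_tensor ::
  "('a, 'm) ring_scheme \<Rightarrow> ('b, 'n) ring_scheme \<Rightarrow> 'a \<Rightarrow> 'b \<Rightarrow> ('a \<times> 'b \<Rightarrow>\<^sub>0 int) set" where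
  "pure_tensor A B a b = tensor_kernel A B +>\<^bsub>int_monoid_ring (A \<times>\<times> B)\<^esub> frag_of (a, b)"

definition linear_extension :: "('c, 'm) ring_scheme \<Rightarrow> ('x \<Rightarrow> 'c) \<Rightarrow> ('x \<Rightarrow>\<^sub>0 int) \<Rightarrow> 'c" where
  "linear_extension C f p =
    (\<Oplus>\<^bsub>C\<^esub>x\<in>Poly_Mapping.keys p. [Poly_Mapping.lookup p x] \<cdot>\<^bsub>C\<^esub> f x)"

text \<open>The linear map out of a tensor product induced by a biadditive map \<open>f\<close> into \<open>C\<close>, that is,
  \<open>a \<otimes> b \<mapsto> f (a, b)\<close>; for biadditive \<open>f\<close> the set below is a singleton.\<close>

definition tensor_lift ::
  "('c, 'm) ring_scheme \<Rightarrow> ('a \<times> 'b \<Rightarrow> 'c) \<Rightarrow> ('a \<times> 'b \<Rightarrow>\<^sub>0 int) set \<Rightarrow> 'c" where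
  "tensor_lift C f T = the_elem (linear_extension C f ` T)"

text \<open>\<open>f \<otimes> g\<close>, for maps \<open>f\<close> into \<open>C\<close> and \<open>g\<close> into \<open>D\<close>.\<close>

definition tensor_map ::
  "('c, 'm) ring_scheme \<Rightarrow> ('d, 'n) ring_scheme \<Rightarrow> ('a \<Rightarrow> 'c) \<Rightarrow> ('b \<Rightarrow> 'd) \<Rightarrow>
    ('a \<times> 'b \<Rightarrow>\<^sub>0 int) set \<Rightarrow> ('c \<times> 'd \<Rightarrow>\<^sub>0 int) set" where
  "tensor_map C D f g = tensor_lift (tensor_ring C D) (\<lambda>(a, b). pure_tensor C D (f a) (g b))"

text \<open>The canonical maps \<open>(A \<otimes> B) \<otimes> C \<rightarrow> A \<otimes> (B \<otimes> C)\<close>, \<open>\<int> \<otimes> A \<rightarrow> A\<close>, \<open>A \<otimes> \<int> \<rightarrow> A\<close>, and the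
  multiplication \<open>A \<otimes> A \<rightarrow> A\<close>.\<close>

definition tensor_assoc where
  "tensor_assoc A B C =
    tensor_lift (tensor_ring A (tensor_ring B C))
      (\<lambda>(T, c). tensor_lift (tensor_ring A (tensor_ring B C))
        (\<lambda>(a, b). pure_tensor A (tensor_ring B C) a (pure_tensor B C b c)) T)"

definition tensor_lunit :: "('a, 'm) ring_scheme \<Rightarrow> (int \<times> 'a \<Rightarrow>\<^sub>0 int) set \<Rightarrow> 'a" where
  "tensor_lunit A = tensor_lift A (\<lambda>(k, a). [k] \<cdot>\<^bsub>A\<^esub> a)"

definition tensor_runit :: "('a, 'm) ring_scheme \<Rightarrow> ('a \<times> int \<Rightarrow>\<^sub>0 int) set \<Rightarrow> 'a" where
  "tensor_runit A = tensor_lift A (\<lambda>(a, k). [k] \<cdot>\<^bsub>A\<^esub> a)"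

definition tensor_mult :: "('a, 'm) ring_scheme \<Rightarrow> ('a \<times> 'a \<Rightarrow>\<^sub>0 int) set \<Rightarrow> 'a" where
  "tensor_mult A = tensor_lift A (\<lambda>(a, b). a \<otimes>\<^bsub>A\<^esub> b)"


section \<open>Hopf algebras over the integers\<close>

locale int_hopf_algebra = ring H for H (structure) +
  fixes \<Delta> :: "'a \<Rightarrow> ('a \<times> 'a \<Rightarrow>\<^sub>0 int) set"
    and \<epsilon> :: "'a \<Rightarrow> int"
    and S :: "'a \<Rightarrow> 'a"
  assumes coproduct_hom: "\<Delta> \<in> ring_hom H (tensor_ring H H)"
    and counit_hom: "\<epsilon> \<in> ring_hom H \<Z>"
    and coassoc: "x \<in> carrier H \<Longrightarrow>
      tensor_assoc H H H (tensor_map (tensor_ring H H) H \<Delta> (\<lambda>y. y) (\<Delta> x)) =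
      tensor_map H (tensor_ring H H) (\<lambda>y. y) \<Delta> (\<Delta> x)"
    and counit_left: "x \<in> carrier H \<Longrightarrow> tensor_lunit H (tensor_map \<Z> H \<epsilon> (\<lambda>y. y) (\<Delta> x)) = x"
    and counit_right: "x \<in> carrier H \<Longrightarrow> tensor_runit H (tensor_map H \<Z> (\<lambda>y. y) \<epsilon> (\<Delta> x)) = x"
    and antipode_linear: "S \<in> hom (add_monoid H) (add_monoid H)"
    and antipode_left: "x \<in> carrier H \<Longrightarrow>
      tensor_mult H (tensor_map H H S (\<lambda>y. y) (\<Delta> x)) = [\<epsilon> x] \<cdot> \<one>"
    and antipode_right: "x \<in> carrier H \<Longrightarrow>
      tensor_mult H (tensor_map H H (\<lambda>y. y) S (\<Delta> x)) = [\<epsilon> x] \<cdot> \<one>"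

definition opposite_ring :: "('a, 'm) ring_scheme \<Rightarrow> ('a, 'm) ring_scheme" where
  "opposite_ring R = R\<lparr>monoid.mult := (\<lambda>x y. y \<otimes>\<^bsub>R\<^esub> x)\<rparr>"

definition ring_anti_automorphism :: "('a, 'm) ring_scheme \<Rightarrow> ('a \<Rightarrow> 'a) \<Rightarrow> bool" where
  "ring_anti_automorphism R f \<longleftrightarrow> f \<in> ring_iso R (opposite_ring R)"


section \<open>The algebra \<open>H(S\<^sub>n)\<close>\<close>

datatype gen = Gen_s nat | Gen_D nat

definition gens :: "nat \<Rightarrow> gen set" where
  "gens n = Gen_s ` {1..n-1} \<union> Gen_D ` {1..n-1}"

text \<open>\<open>hecke_hopf_rel F s D n l r\<close>: the equation \<open>l = r\<close> is one of the defining relations, written in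
  the ring \<open>F\<close> for elements \<open>s i\<close>, \<open>D i\<close>.\<close>

inductive hecke_hopf_rel ::
  "('a, 'm) ring_scheme \<Rightarrow> (nat \<Rightarrow> 'a) \<Rightarrow> (nat \<Rightarrow> 'a) \<Rightarrow> nat \<Rightarrow> 'a \<Rightarrow> 'a \<Rightarrow> bool"
  for F (structure) and s D n where
  s_sq: "i \<in> {1..n-1} \<Longrightarrow> hecke_hopf_rel F s D n (s i \<otimes> s i) \<one>"
| s_D: "i \<in> {1..n-1} \<Longrightarrow>
    hecke_hopf_rel F s D n (s i \<otimes> D i \<oplus> D i \<otimes> s i) (s i \<ominus> \<one>)"
| D_sq: "i \<in> {1..n-1} \<Longrightarrow> hecke_hopf_rel F s D n (D i \<otimes> D i) (D i)"
| far_ss: "i \<in> {1..n-1} \<Longrightarrow> j \<in> {1..n-1} \<Longrightarrow> \<bar>int i - int j\<bar> > 1 \<Longrightarrow>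
    hecke_hopf_rel F s D n (s j \<otimes> s i) (s i \<otimes> s j)"
| far_Ds: "i \<in> {1..n-1} \<Longrightarrow> j \<in> {1..n-1} \<Longrightarrow> \<bar>int i - int j\<bar> > 1 \<Longrightarrow>
    hecke_hopf_rel F s D n (D j \<otimes> s i) (s i \<otimes> D j)"
| far_DD: "i \<in> {1..n-1} \<Longrightarrow> j \<in> {1..n-1} \<Longrightarrow> \<bar>int i - int j\<bar> > 1 \<Longrightarrow>
    hecke_hopf_rel F s D n (D j \<otimes> D i) (D i \<otimes> D j)"
| braid_sss: "i \<in> {1..n-1} \<Longrightarrow> j \<in> {1..n-1} \<Longrightarrow> \<bar>int i - int j\<bar> = 1 \<Longrightarrow>
    hecke_hopf_rel F s D n (s j \<otimes> s i \<otimes> s j) (s i \<otimes> s j \<otimes> s i)"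
| braid_Dss: "i \<in> {1..n-1} \<Longrightarrow> j \<in> {1..n-1} \<Longrightarrow> \<bar>int i - int j\<bar> = 1 \<Longrightarrow>
    hecke_hopf_rel F s D n (D i \<otimes> s j \<otimes> s i) (s j \<otimes> s i \<otimes> D j)"
| braid_DsD: "i \<in> {1..n-1} \<Longrightarrow> j \<in> {1..n-1} \<Longrightarrow> \<bar>int i - int j\<bar> = 1 \<Longrightarrow>
    hecke_hopf_rel F s D n (D j \<otimes> s i \<otimes> D j)
      (s i \<otimes> D j \<otimes> D i \<oplus> D i \<otimes> D j \<otimes> s i \<oplus> s i \<otimes> D j \<otimes> s i)"

abbreviation hecke_hopf_free :: "nat \<Rightarrow> (gen list \<Rightarrow>\<^sub>0 int) ring" where
  "hecke_hopf_free n \<equiv> free_ring (gens n)"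

text \<open>\<^const>\<open>genideal\<close> is the generated two-sided ideal.\<close>

definition hecke_hopf_ideal :: "nat \<Rightarrow> (gen list \<Rightarrow>\<^sub>0 int) set" where
  "hecke_hopf_ideal n =
    genideal (hecke_hopf_free n)
      {l \<ominus>\<^bsub>hecke_hopf_free n\<^esub> r | l r.
        hecke_hopf_rel (hecke_hopf_free n) (\<lambda>i. free_gen (Gen_s i)) (\<lambda>i. free_gen (Gen_D i)) n l r}"

definition hecke_hopf :: "nat \<Rightarrow> (gen list \<Rightarrow>\<^sub>0 int) set ring" where
  "hecke_hopf n = hecke_hopf_free n Quot hecke_hopf_ideal n"

definition hh_s :: "nat \<Rightarrow> nat \<Rightarrow> (gen list \<Rightarrow>\<^sub>0 int) set" where
  "hh_s n i = hecke_hopf_ideal n +>\<^bsub>hecke_hopf_free n\<^esub> free_gen (Gen_s i)"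

definition hh_D :: "nat \<Rightarrow> nat \<Rightarrow> (gen list \<Rightarrow>\<^sub>0 int) set" where
  "hh_D n i = hecke_hopf_ideal n +>\<^bsub>hecke_hopf_free n\<^esub> free_gen (Gen_D i)"

end

theory Submission
  imports Defs "HOL-Algebra.Generated_Rings"
begin

text \<open>By the universal property of the presentation, the prescribed values on generators extend to ring
  homomorphisms \<open>\<Delta>: H \<rightarrow> H \<otimes> H\<close>, \<open>\<epsilon>: H \<rightarrow> \<int>\<close> and \<open>S: H \<rightarrow> H\<^sup>o\<^sup>p\<close> once they satisfy the defining relations.
  Coassociativity and the counit laws equate ring homomorphisms, and the antipode law is inherited by
  products because \<open>S\<close> is anti-multiplicative, so all the axioms reduce to the generators. Finally
  \<open>S\<close> is bijective because \<open>S\<^sup>4 = id\<close>.\<close>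

section \<open>Additive maps\<close>

text \<open>The value S(D_i) = -s_i D_i is forced: S * id must vanish on D_i, that is, S(D_i) +
  S(s_i) D_i = 0. All calculations use nothing but the relations, never a basis of H. They are
  therefore made for an arbitrary ring with elements satisfying the relations
  (\<open>hecke_hopf_family\<close>), and H \<otimes> H, \<int> and the opposite ring only have to
  be recognised as further instances. The laborious relation is the one for D_j s_i D_j. In H
  \<otimes> H it closes because s_i = s_i D_i + D_i s_i + 1 splits one tensor leg; in the opposite
  ring it closes after s_i s_j s_i is factored out of every term. The antipode laws cannot be
  compared as ring homomorphisms, because the multiplication H \<otimes> H \<rightarrow> H is only
  additive when H is not commutative. What saves the reduction to generators is that both sides are
  integer multiples of 1: such a multiple is central and can be pulled out from between two other
  factors. Tensors are concrete cosets of formal sums, so each map out of a tensor product first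
  needs a proof that it is constant on cosets; after that, identities are checked on pure
  tensors.\<close>

context
  fixes A :: "('a, 'm) ring_scheme" and B :: "('b, 'n) ring_scheme" and f
  assumes A: "abelian_group A" and B: "abelian_group B"
    and f: "f \<in> hom (add_monoid A) (add_monoid B)"
begin

interpretation abelian_group_hom A B f
  using A B f
  by (intro abelian_group_hom.intro abelian_group_hom_axioms.intro group_hom.intro
      group_hom_axioms.intro abelian_group.a_group)

lemma add_hom_zero: "f \<zero>\<^bsub>A\<^esub> = \<zero>\<^bsub>B\<^esub>"
  by simp

lemma add_hom_a_inv: "x \<in> carrier A \<Longrightarrow> f (\<ominus>\<^bsub>A\<^esub> x) = \<ominus>\<^bsub>B\<^esub> f x"
  by simp

lemma add_hom_minus:
  "x \<in> carrier A \<Longrightarrow> y \<in> carrier A \<Longrightarrow> f (x \<ominus>\<^bsub>A\<^esub> y) = f x \<ominus>\<^bsub>B\<^esub> f y"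
  by (simp add: a_minus_def)

end

lemma add_hom_closed:
  "f \<in> hom (add_monoid A) (add_monoid B) \<Longrightarrow> x \<in> carrier A \<Longrightarrow> f x \<in> carrier B"
  by (auto simp: hom_def)

lemma add_hom_add:
  "f \<in> hom (add_monoid A) (add_monoid B) \<Longrightarrow> x \<in> carrier A \<Longrightarrow> y \<in> carrier A \<Longrightarrow>
    f (x \<oplus>\<^bsub>A\<^esub> y) = f x \<oplus>\<^bsub>B\<^esub> f y"
  by (auto simp: hom_def)

lemma add_homI:
  assumes "\<And>x. x \<in> carrier A \<Longrightarrow> f x \<in> carrier B"
    and "\<And>x y. x \<in> carrier A \<Longrightarrow> y \<in> carrier A \<Longrightarrow> f (x \<oplus>\<^bsub>A\<^esub> y) = f x \<oplus>\<^bsub>B\<^esub> f y"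
  shows "f \<in> hom (add_monoid A) (add_monoid B)"
  using assms by (auto simp: hom_def)

section \<open>Quotients by ideals\<close>

text \<open>An additive map that kills \<open>I\<close> is constant on each coset, so the image of a
  coset is a singleton and \<open>the_elem\<close> reads off the common value. Both
  \<open>tensor_lift\<close> and the maps out of the presented algebra have this form.\<close>

lemma (in abelian_group) the_elem_add_hom_image_coset:
  assumes C: "abelian_group C" and f: "f \<in> hom (add_monoid G) (add_monoid C)"
    and I: "subgroup I (add_monoid G)" and zero: "\<And>x. x \<in> I \<Longrightarrow> f x = \<zero>\<^bsub>C\<^esub>"
    and x: "x \<in> carrier G"
  shows "the_elem (f ` (I +> x)) = f x"
proof -
  interpret C: abelian_group C by (rule C)
  have sub: "I \<subseteq> carrier G" and "\<zero> \<in> I"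
    using subgroup.subset[OF I] subgroup.one_closed[OF I] by auto
  have "f (y \<oplus> x) = f x" if "y \<in> I" for y
    using that sub x zero add_hom_add[OF f] add_hom_closed[OF f] by auto
  then have "f ` (I +> x) = {f x}"
    using \<open>\<zero> \<in> I\<close> by (auto simp: a_r_coset_def' image_UN)
  then show ?thesis by simp
qed

context ideal
begin

lemma FactRing_cases:
  assumes "X \<in> carrier (R Quot I)"
  obtains x where "x \<in> carrier R" "X = I +> x"
  using assms by (auto simp: FactRing_def A_RCOSETS_def')

text \<open>Only additivity is asked of \<open>f\<close>, since maps out of a tensor product, such
  as \<open>tensor_mult\<close>, need not be multiplicative.\<close>

lemma quotient_lift_add_hom:
  assumes C: "abelian_group C" and f: "f \<in> hom (add_monoid R) (add_monoid C)"
    and zero: "\<And>x. x \<in> I \<Longrightarrow> f x = \<zero>\<^bsub>C\<^esub>"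
  shows "(\<lambda>X. the_elem (f ` X)) \<in> hom (add_monoid (R Quot I)) (add_monoid C)"
    and "x \<in> carrier R \<Longrightarrow> the_elem (f ` (I +> x)) = f x"
proof -
  note lift = the_elem_add_hom_image_coset[OF C f a_subgroup zero]
  show "x \<in> carrier R \<Longrightarrow> the_elem (f ` (I +> x)) = f x"
    by (rule lift)
  show "(\<lambda>X. the_elem (f ` X)) \<in> hom (add_monoid (R Quot I)) (add_monoid C)"
  proof (rule add_homI)
    fix X assume "X \<in> carrier (R Quot I)"
    then show "the_elem (f ` X) \<in> carrier C"
      by (elim FactRing_cases) (simp add: lift add_hom_closed[OF f])
  next
    fix X Y assume "X \<in> carrier (R Quot I)" "Y \<in> carrier (R Quot I)"
    then show "the_elem (f ` (X \<oplus>\<^bsub>R Quot I\<^esub> Y)) = the_elem (f ` X) \<oplus>\<^bsub>C\<^esub> the_elem (f ` Y)"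
      by (elim FactRing_cases)
        (simp add: lift add_hom_add[OF f] ring_hom_add[OF rcos_ring_hom, symmetric])
  qed
qed

lemma quotient_lift_ring_hom:
  assumes C: "ring C" and f: "f \<in> ring_hom R C"
    and zero: "\<And>x. x \<in> I \<Longrightarrow> f x = \<zero>\<^bsub>C\<^esub>"
  shows "(\<lambda>X. the_elem (f ` X)) \<in> ring_hom (R Quot I) C"
proof -
  note add = quotient_lift_add_hom[OF ring.is_abelian_group[OF C] ring_hom_in_hom(2)[OF f] zero]
  show ?thesis
  proof (rule ring_hom_memI)
    fix X Y assume "X \<in> carrier (R Quot I)" "Y \<in> carrier (R Quot I)"
    then show "the_elem (f ` (X \<otimes>\<^bsub>R Quot I\<^esub> Y)) = the_elem (f ` X) \<otimes>\<^bsub>C\<^esub> the_elem (f ` Y)"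
      by (elim FactRing_cases)
        (simp add: add(2) ring_hom_mult[OF f] ring_hom_mult[OF rcos_ring_hom, symmetric])
  next
    show "the_elem (f ` \<one>\<^bsub>R Quot I\<^esub>) = \<one>\<^bsub>C\<^esub>"
      by (simp add: ring_hom_one[OF rcos_ring_hom, symmetric] add(2) ring_hom_one[OF f])
  qed (use add_hom_closed[OF add(1)] add_hom_add[OF add(1)] in auto)
qed

end

section \<open>Integral monoid rings\<close>

lemma carrier_int_monoid_ring [simp]:
  "p \<in> carrier (int_monoid_ring M) \<longleftrightarrow> Poly_Mapping.keys p \<subseteq> carrier M"
  by (simp add: int_monoid_ring_def)

lemma zero_int_monoid_ring [simp]: "\<zero>\<^bsub>int_monoid_ring M\<^esub> = 0"
  and one_int_monoid_ring: "\<one>\<^bsub>int_monoid_ring M\<^esub> = frag_of \<one>\<^bsub>M\<^esub>"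
  and add_int_monoid_ring [simp]: "p \<oplus>\<^bsub>int_monoid_ring M\<^esub> q = p + q"
  and mult_int_monoid_ring: "p \<otimes>\<^bsub>int_monoid_ring M\<^esub> q =
    frag_extend (\<lambda>a. frag_extend (\<lambda>b. frag_of (a \<otimes>\<^bsub>M\<^esub> b)) q) p"
  by (simp_all add: int_monoid_ring_def)

lemma frag_of_mult_int_monoid_ring [simp]:
  "frag_of a \<otimes>\<^bsub>int_monoid_ring M\<^esub> frag_of b = frag_of (a \<otimes>\<^bsub>M\<^esub> b)"
  by (simp add: mult_int_monoid_ring)

text \<open>In the product of the monoid ring the second factor sits inside the function passed to
  \<open>frag_extend\<close>; this law makes the product additive in that factor.\<close>

lemma frag_extend_fun_add:
  "frag_extend (\<lambda>a. f a + g a) p = frag_extend f p + frag_extend g p"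
  by (simp add: frag_extend_def frag_cmul_distrib2 sum.distrib)

lemma frag_extend_fun_diff:
  "frag_extend (\<lambda>a. f a - g a) p = frag_extend f p - frag_extend g p"
  using frag_extend_fun_add[of "\<lambda>a. f a - g a" g p] by simp

lemma mult_diff_int_monoid_ring:
  "(p - q) \<otimes>\<^bsub>int_monoid_ring M\<^esub> r = p \<otimes>\<^bsub>int_monoid_ring M\<^esub> r - q \<otimes>\<^bsub>int_monoid_ring M\<^esub> r"
  "r \<otimes>\<^bsub>int_monoid_ring M\<^esub> (p - q) = r \<otimes>\<^bsub>int_monoid_ring M\<^esub> p - r \<otimes>\<^bsub>int_monoid_ring M\<^esub> q"
  by (simp_all add: mult_int_monoid_ring frag_extend_diff frag_extend_fun_diff)

lemma mult_zero_int_monoid_ring: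
  "0 \<otimes>\<^bsub>int_monoid_ring M\<^esub> r = 0" "r \<otimes>\<^bsub>int_monoid_ring M\<^esub> 0 = 0"
  by (simp_all add: mult_int_monoid_ring frag_extend_eq_0)

lemma keys_diff_subset:
  assumes "Poly_Mapping.keys p \<subseteq> V" "Poly_Mapping.keys q \<subseteq> V"
  shows "Poly_Mapping.keys (p - q :: 'a \<Rightarrow>\<^sub>0 int) \<subseteq> V"
  using keys_diff[of p q] assms by blast

lemma keys_add_subset:
  assumes "Poly_Mapping.keys p \<subseteq> V" "Poly_Mapping.keys q \<subseteq> V"
  shows "Poly_Mapping.keys (p + q :: 'a \<Rightarrow>\<^sub>0 int) \<subseteq> V"
  using keys_add[of p q] assms by blast

text \<open>The difference step of \<open>frag_induction\<close> forgets that both arguments are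
  supported in \<open>V\<close>. Carrying the support condition through the induction restores it
  for the closure side conditions.\<close>

lemma frag_induct_subset [consumes 1, case_names zero one diff]:
  assumes "Poly_Mapping.keys p \<subseteq> V"
    and "P 0" "\<And>x. x \<in> V \<Longrightarrow> P (frag_of x)"
    and "\<And>p q. Poly_Mapping.keys p \<subseteq> V \<Longrightarrow> Poly_Mapping.keys q \<subseteq> V \<Longrightarrow> P p \<Longrightarrow> P q \<Longrightarrow> P (p - q)"
  shows "P p"
proof -
  have "Poly_Mapping.keys p \<subseteq> V \<and> P p"
    using assms(1) by (induction rule: frag_induction) (auto intro: assms(2-4) dest!: subsetD[OF keys_diff])
  then show ?thesis ..
qed

context monoid
begin

lemma keys_mult_int_monoid_ring:
  assumes "Poly_Mapping.keys p \<subseteq> carrier G" "Poly_Mapping.keys q \<subseteq> carrier G"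
  shows "Poly_Mapping.keys (p \<otimes>\<^bsub>int_monoid_ring G\<^esub> q) \<subseteq> carrier G"
proof -
  have "Poly_Mapping.keys (frag_extend (\<lambda>b. frag_of (a \<otimes> b)) q) \<subseteq> carrier G"
    if "a \<in> carrier G" for a
    using that assms(2) by (intro order_trans[OF keys_frag_extend]) auto
  then show ?thesis
    unfolding mult_int_monoid_ring using assms(1)
    by (intro order_trans[OF keys_frag_extend]) blast
qed

text \<open>Both sides are additive in each argument, so three nested inductions leave only the
  associativity of basis elements.\<close>

lemma int_monoid_ring_assoc:
  assumes "Poly_Mapping.keys p \<subseteq> carrier G" "Poly_Mapping.keys q \<subseteq> carrier G"
    "Poly_Mapping.keys r \<subseteq> carrier G"
  shows "(p \<otimes>\<^bsub>int_monoid_ring G\<^esub> q) \<otimes>\<^bsub>int_monoid_ring G\<^esub> r =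
    p \<otimes>\<^bsub>int_monoid_ring G\<^esub> (q \<otimes>\<^bsub>int_monoid_ring G\<^esub> r)"
  using assms(1)
proof (induction rule: frag_induct_subset)
  case (one x)
  show ?case
    using assms(2)
  proof (induction rule: frag_induct_subset)
    case (one y)
    show ?case
      using assms(3) \<open>x \<in> carrier G\<close> one
      by (induction rule: frag_induct_subset)
        (simp_all add: mult_zero_int_monoid_ring mult_diff_int_monoid_ring m_assoc)
  qed (simp_all add: mult_zero_int_monoid_ring mult_diff_int_monoid_ring)
qed (simp_all add: mult_zero_int_monoid_ring mult_diff_int_monoid_ring)

lemma ring_int_monoid_ring: "ring (int_monoid_ring G)"
proof (rule ringI)
  show "abelian_group (int_monoid_ring G)"
  proof (rule abelian_groupI)
    fix p assume "p \<in> carrier (int_monoid_ring G)"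
    then show "\<exists>q\<in>carrier (int_monoid_ring G). q \<oplus>\<^bsub>int_monoid_ring G\<^esub> p = \<zero>\<^bsub>int_monoid_ring G\<^esub>"
      by (intro bexI[of _ "- p"]) auto
  qed (auto simp: keys_add_subset add.assoc add.commute)
  show "monoid (int_monoid_ring G)"
  proof (rule monoidI)
    fix p assume p: "p \<in> carrier (int_monoid_ring G)"
    have *: "frag_of \<one> \<otimes>\<^bsub>int_monoid_ring G\<^esub> p = p \<and> p \<otimes>\<^bsub>int_monoid_ring G\<^esub> frag_of \<one> = p"
      using p[unfolded carrier_int_monoid_ring]
      by (induction rule: frag_induct_subset)
        (simp_all add: mult_zero_int_monoid_ring mult_diff_int_monoid_ring)
    then show "\<one>\<^bsub>int_monoid_ring G\<^esub> \<otimes>\<^bsub>int_monoid_ring G\<^esub> p = p"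
      "p \<otimes>\<^bsub>int_monoid_ring G\<^esub> \<one>\<^bsub>int_monoid_ring G\<^esub> = p"
      by (simp_all add: one_int_monoid_ring)
  qed (auto simp: one_int_monoid_ring int_monoid_ring_assoc
      dest: subsetD[OF keys_mult_int_monoid_ring])
qed (simp_all add: mult_int_monoid_ring frag_extend_add frag_extend_fun_add)

lemma minus_int_monoid_ring:
  assumes "Poly_Mapping.keys p \<subseteq> carrier G"
  shows "\<ominus>\<^bsub>int_monoid_ring G\<^esub> p = - p"
proof -
  interpret R: ring "int_monoid_ring G" by (rule ring_int_monoid_ring)
  show ?thesis
    using R.minus_equality[of "- p" p] assms by simp
qed

lemma diff_int_monoid_ring:
  assumes "Poly_Mapping.keys q \<subseteq> carrier G"
  shows "p \<ominus>\<^bsub>int_monoid_ring G\<^esub> q = p - q"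
  using assms by (simp add: a_minus_def minus_int_monoid_ring)

end

text \<open>Indices outside the support contribute zero. Additivity needs this because p, q and p +
  q have different supports and must be summed over a common index set.\<close>

lemma (in abelian_group) linear_extension_superset:
  assumes "finite K" "Poly_Mapping.keys p \<subseteq> K" "f \<in> K \<rightarrow> carrier G"
  shows "linear_extension G f p = (\<Oplus>x\<in>K. [Poly_Mapping.lookup p x] \<cdot> f x)"
proof -
  have pow: "[k] \<cdot> f x \<in> carrier G" if "x \<in> K" for x and k :: int
    using assms(3) that by (intro add.int_pow_closed) auto
  have "[Poly_Mapping.lookup p x] \<cdot> f x = \<zero>" if "x \<notin> Poly_Mapping.keys p" for x
    using that by (simp add: in_keys_iff add_pow_def)
  then show ?thesis
    unfolding linear_extension_def
    using assms by (intro add.finprod_mono_neutral_cong_left) (auto intro!: pow)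
qed

lemma (in abelian_group) linear_extension_frag_of [simp]:
  assumes "f x \<in> carrier G"
  shows "linear_extension G f (frag_of x) = f x"
  using assms by (simp add: linear_extension_def)

lemma (in abelian_group) linear_extension_add_hom:
  assumes f: "f \<in> carrier M \<rightarrow> carrier G"
  shows "linear_extension G f \<in> hom (add_monoid (int_monoid_ring M)) (add_monoid G)"
proof (rule add_homI)
  have f': "f x \<in> carrier G" if "x \<in> carrier M" for x
    using that f by auto
  have pow: "[k] \<cdot> f x \<in> carrier G" if "x \<in> carrier M" for x and k :: int
    using f'[OF that] by (rule add.int_pow_closed)
  fix p assume p: "p \<in> carrier (int_monoid_ring M)"
  then show "linear_extension G f p \<in> carrier G"
    unfolding linear_extension_def by (intro finsum_closed) (auto intro!: pow)
  fix q assume q: "q \<in> carrier (int_monoid_ring M)"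
  define K where "K = Poly_Mapping.keys p \<union> Poly_Mapping.keys q"
  have K: "finite K" "K \<subseteq> carrier M" "Poly_Mapping.keys p \<subseteq> K" "Poly_Mapping.keys q \<subseteq> K"
    "Poly_Mapping.keys (p + q) \<subseteq> K" "f \<in> K \<rightarrow> carrier G"
    using p q f by (auto simp: K_def dest: subsetD[OF keys_add])
  have "(\<Oplus>x\<in>K. [Poly_Mapping.lookup (p + q) x] \<cdot> f x) =
    (\<Oplus>x\<in>K. [Poly_Mapping.lookup p x] \<cdot> f x \<oplus> [Poly_Mapping.lookup q x] \<cdot> f x)"
    using K(2) by (intro finsum_cong' refl) (auto simp: lookup_add add.int_pow_mult f' pow subset_iff)
  also have "\<dots> = (\<Oplus>x\<in>K. [Poly_Mapping.lookup p x] \<cdot> f x) \<oplus> (\<Oplus>x\<in>K. [Poly_Mapping.lookup q x] \<cdot> f x)"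
    using K(2) by (intro finsum_addf) (auto intro!: pow)
  finally show "linear_extension G f (p \<oplus>\<^bsub>int_monoid_ring M\<^esub> q) =
    linear_extension G f p \<oplus> linear_extension G f q"
    by (simp add: linear_extension_superset[of K] K)
qed

text \<open>Universal property of the monoid ring. Both sides of multiplicativity are biadditive,
  and on basis elements it is the hypothesis on \<open>f\<close>.\<close>

lemma (in ring) linear_extension_ring_hom:
  assumes M: "monoid M" and f: "f \<in> hom M R" and one: "f \<one>\<^bsub>M\<^esub> = \<one>"
  shows "linear_extension R f \<in> ring_hom (int_monoid_ring M) R"
proof -
  interpret M: monoid M by (rule M)
  interpret Z: ring "int_monoid_ring M" by (rule M.ring_int_monoid_ring)
  have f': "f x \<in> carrier R" if "x \<in> carrier M" for x
    using that f by (auto simp: hom_def)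
  have h: "linear_extension R f \<in> hom (add_monoid (int_monoid_ring M)) (add_monoid R)"
    by (rule linear_extension_add_hom) (auto simp: f')
  note hom_zero = add_hom_zero[OF Z.is_abelian_group is_abelian_group h, simplified]
  note closed = add_hom_closed[OF h, simplified]
  have hom_diff: "linear_extension R f (p - q) = linear_extension R f p \<ominus> linear_extension R f q"
    if "Poly_Mapping.keys p \<subseteq> carrier M" "Poly_Mapping.keys q \<subseteq> carrier M" for p q
    using add_hom_minus[OF Z.is_abelian_group is_abelian_group h, of p q] that
    by (simp add: M.diff_int_monoid_ring)
  show ?thesis
  proof (rule ring_hom_memI)
    fix p q assume "p \<in> carrier (int_monoid_ring M)" "q \<in> carrier (int_monoid_ring M)"
    then have p: "Poly_Mapping.keys p \<subseteq> carrier M" and q: "Poly_Mapping.keys q \<subseteq> carrier M"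
      by simp_all
    from p show "linear_extension R f (p \<otimes>\<^bsub>int_monoid_ring M\<^esub> q) =
      linear_extension R f p \<otimes> linear_extension R f q"
    proof (induction rule: frag_induct_subset)
      case zero
      show ?case by (simp add: mult_zero_int_monoid_ring hom_zero closed q)
    next
      case (one x)
      from q show ?case
      proof (induction rule: frag_induct_subset)
        case zero
        show ?case using one by (simp add: mult_zero_int_monoid_ring hom_zero f')
      next
        case (one y)
        then show ?case
          using \<open>x \<in> carrier M\<close> f by (simp add: f' hom_mult)
      next
        case (diff p q)
        then show ?case
          using one by (simp add: mult_diff_int_monoid_ring hom_diff closed f'
              M.keys_mult_int_monoid_ring r_distr a_minus_def r_minus)
      qed
    next
      case (diff p' q')
      then show ?case
        using q by (simp add: mult_diff_int_monoid_ring hom_diff closed 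
              M.keys_mult_int_monoid_ring l_distr a_minus_def l_minus)
    qed
  qed (use add_hom_closed[OF h] add_hom_add[OF h] one in \<open>auto simp: one_int_monoid_ring\<close>)
qed

section \<open>Tensor products of rings\<close>

definition biadditive ::
  "('a, 'm) ring_scheme \<Rightarrow> ('b, 'n) ring_scheme \<Rightarrow> ('c, 'k) ring_scheme \<Rightarrow> ('a \<times> 'b \<Rightarrow> 'c) \<Rightarrow> bool"
  where "biadditive A B C f \<longleftrightarrow>
    (\<forall>b\<in>carrier B. (\<lambda>a. f (a, b)) \<in> hom (add_monoid A) (add_monoid C)) \<and>
    (\<forall>a\<in>carrier A. (\<lambda>b. f (a, b)) \<in> hom (add_monoid B) (add_monoid C))"

lemma biadditiveI:
  assumes "\<And>a b. a \<in> carrier A \<Longrightarrow> b \<in> carrier B \<Longrightarrow> f (a, b) \<in> carrier C"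
    and "\<And>a a' b. a \<in> carrier A \<Longrightarrow> a' \<in> carrier A \<Longrightarrow> b \<in> carrier B \<Longrightarrow>
      f (a \<oplus>\<^bsub>A\<^esub> a', b) = f (a, b) \<oplus>\<^bsub>C\<^esub> f (a', b)"
    and "\<And>a b b'. a \<in> carrier A \<Longrightarrow> b \<in> carrier B \<Longrightarrow> b' \<in> carrier B \<Longrightarrow>
      f (a, b \<oplus>\<^bsub>B\<^esub> b') = f (a, b) \<oplus>\<^bsub>C\<^esub> f (a, b')"
  shows "biadditive A B C f"
  using assms by (auto simp: biadditive_def hom_def)

locale two_rings = A: ring A + B: ring B
  for A :: "('a, 'm) ring_scheme" and B :: "('b, 'n) ring_scheme"
begin

abbreviation "Z \<equiv> int_monoid_ring (A \<times>\<times> B)"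
abbreviation "K \<equiv> tensor_kernel A B"
abbreviation "T \<equiv> tensor_ring A B"
abbreviation "pure \<equiv> pure_tensor A B"

lemma monoid_DirProd: "monoid (A \<times>\<times> B)"
  by (intro DirProd_monoid A.is_monoid B.is_monoid)

interpretation M: monoid "A \<times>\<times> B"
  by (rule monoid_DirProd)

interpretation Z: ring Z
  by (rule M.ring_int_monoid_ring)

lemma biadditive_rels_subset: "biadditive_rels A B \<subseteq> carrier Z"
  by (auto simp: biadditive_rels_def dest!: subsetD[OF keys_diff])

lemma biadditive_relsI:
  "a \<in> carrier A \<Longrightarrow> a' \<in> carrier A \<Longrightarrow> b \<in> carrier B \<Longrightarrow>
    frag_of (a \<oplus>\<^bsub>A\<^esub> a', b) - frag_of (a, b) - frag_of (a', b) \<in> biadditive_rels A B"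
  "a \<in> carrier A \<Longrightarrow> b \<in> carrier B \<Longrightarrow> b' \<in> carrier B \<Longrightarrow>
    frag_of (a, b \<oplus>\<^bsub>B\<^esub> b') - frag_of (a, b) - frag_of (a, b') \<in> biadditive_rels A B"
  unfolding biadditive_rels_def by blast+

text \<open>Distributivity in one factor turns a relation, multiplied by a basis element, into
  another relation of the same kind. This is the core of the ideal property of
  \<open>tensor_kernel\<close>.\<close>

lemma biadditive_rels_mult:
  assumes "r \<in> biadditive_rels A B" "c \<in> carrier A" "d \<in> carrier B"
  shows "frag_of (c, d) \<otimes>\<^bsub>Z\<^esub> r \<in> biadditive_rels A B"
    and "r \<otimes>\<^bsub>Z\<^esub> frag_of (c, d) \<in> biadditive_rels A B"
proof -
  from assms(1) consider
    a a' b where "r = frag_of (a \<oplus>\<^bsub>A\<^esub> a', b) - frag_of (a, b) - frag_of (a', b)"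
      "a \<in> carrier A" "a' \<in> carrier A" "b \<in> carrier B"
  | a b b' where "r = frag_of (a, b \<oplus>\<^bsub>B\<^esub> b') - frag_of (a, b) - frag_of (a, b')"
      "a \<in> carrier A" "b \<in> carrier B" "b' \<in> carrier B"
    unfolding biadditive_rels_def by blast
  then have "frag_of (c, d) \<otimes>\<^bsub>Z\<^esub> r \<in> biadditive_rels A B \<and> r \<otimes>\<^bsub>Z\<^esub> frag_of (c, d) \<in> biadditive_rels A B"
  proof cases
    case 1
    then show ?thesis
      using assms(2,3)
      by (simp add: mult_diff_int_monoid_ring A.l_distr A.r_distr biadditive_relsI)
  next
    case 2
    then show ?thesis
      using assms(2,3)
      by (simp add: mult_diff_int_monoid_ring B.l_distr B.r_distr biadditive_relsI)
  qed
  then show "frag_of (c, d) \<otimes>\<^bsub>Z\<^esub> r \<in> biadditive_rels A B"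
    and "r \<otimes>\<^bsub>Z\<^esub> frag_of (c, d) \<in> biadditive_rels A B"
    by auto
qed

lemma subgroup_tensor_kernel: "subgroup K (add_monoid Z)"
  unfolding tensor_kernel_def using biadditive_rels_subset
  by (intro Z.add.generate_is_subgroup) simp

lemma tensor_kernel_induct [consumes 1, case_names zero rel minus add]:
  assumes "x \<in> K" and "P 0" "\<And>r. r \<in> biadditive_rels A B \<Longrightarrow> P r"
    and "\<And>r. r \<in> biadditive_rels A B \<Longrightarrow> P (- r)"
    and "\<And>x y. x \<in> K \<Longrightarrow> y \<in> K \<Longrightarrow> P x \<Longrightarrow> P y \<Longrightarrow> P (x + y)"
  shows "P x"
  using assms(1) unfolding tensor_kernel_def
proof (induction rule: generate.induct)
  case (inv r)
  then have "inv\<^bsub>add_monoid Z\<^esub> r = - r"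
    using biadditive_rels_subset M.minus_int_monoid_ring[of r]
    by (auto simp: a_inv_def)
  then show ?case using assms(4)[OF inv] by simp
next
  case (eng h1 h2)
  then show ?case using assms(5)[of h1 h2] by (simp add: tensor_kernel_def)
qed (use assms in auto)

lemma tensor_kernel_closed:
  "0 \<in> K" "x \<in> K \<Longrightarrow> y \<in> K \<Longrightarrow> x + y \<in> K" "x \<in> K \<Longrightarrow> - x \<in> K" "x \<in> K \<Longrightarrow> y \<in> K \<Longrightarrow> x - y \<in> K"
    "x \<in> K \<Longrightarrow> Poly_Mapping.keys x \<subseteq> carrier A \<times> carrier B"
proof -
  note S = subgroup_tensor_kernel
  show "0 \<in> K"
    using subgroup.one_closed[OF S] by simp
  show add: "x + y \<in> K" if "x \<in> K" "y \<in> K" for x y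
    using subgroup.m_closed[OF S that] by simp
  show keys: "Poly_Mapping.keys x \<subseteq> carrier A \<times> carrier B" if "x \<in> K" for x
    using subgroup.mem_carrier[OF S that] by simp
  show minus: "- x \<in> K" if "x \<in> K" for x
    using subgroup.m_inv_closed[OF S that] M.minus_int_monoid_ring[of x] keys[OF that]
    by (simp add: a_inv_def)
  show "x - y \<in> K" if "x \<in> K" "y \<in> K" for x y
    using add[OF that(1) minus[OF that(2)]] by simp
qed

text \<open>The kernel is generated only as an additive subgroup, so absorption of products has to
  be proved: first for a relation times an arbitrary ring element, by induction on that element,
  then for all of the kernel.\<close>

lemma ideal_tensor_kernel: "ideal K Z"
proof (rule idealI)
  show "ring Z" by (rule Z.ring_axioms)
  show "subgroup K (add_monoid Z)" by (rule subgroup_tensor_kernel)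
  have rel_in: "r \<in> K" if "r \<in> biadditive_rels A B" for r
    using that by (auto simp: tensor_kernel_def intro: generate.incl)
  have mult_rel: "x \<otimes>\<^bsub>Z\<^esub> r \<in> K \<and> r \<otimes>\<^bsub>Z\<^esub> x \<in> K"
    if x: "x \<in> carrier Z" and r: "r \<in> biadditive_rels A B" for x r
    using x[unfolded carrier_int_monoid_ring]
  proof (induction rule: frag_induct_subset)
    case (one p)
    then show ?case
      using biadditive_rels_mult[OF r] by (auto intro!: rel_in)
  qed (simp_all add: mult_zero_int_monoid_ring mult_diff_int_monoid_ring tensor_kernel_closed)
  fix a x assume "a \<in> K" and x: "x \<in> carrier Z"
  then have "x \<otimes>\<^bsub>Z\<^esub> a \<in> K \<and> a \<otimes>\<^bsub>Z\<^esub> x \<in> K"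
  proof (induction a rule: tensor_kernel_induct)
    case (rel r)
    show ?case by (rule mult_rel[OF x rel(1)])
  next
    case (minus r)
    have *: "x \<otimes>\<^bsub>Z\<^esub> (- r) = - (x \<otimes>\<^bsub>Z\<^esub> r)" "(- r) \<otimes>\<^bsub>Z\<^esub> x = - (r \<otimes>\<^bsub>Z\<^esub> x)"
      using mult_diff_int_monoid_ring(1)[where M = "A \<times>\<times> B" and p = 0 and q = r and r = x]
        mult_diff_int_monoid_ring(2)[where M = "A \<times>\<times> B" and p = 0 and q = r and r = x]
      by (simp_all add: mult_zero_int_monoid_ring)
    from mult_rel[OF x minus(1)] show ?case by (simp add: * tensor_kernel_closed)
  next
    case (add y z)
    then show ?case
      using x Z.r_distr[of y z x] Z.l_distr[of y z x] tensor_kernel_closed(5)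
      by (auto simp: tensor_kernel_closed)
  qed (simp add: mult_zero_int_monoid_ring tensor_kernel_closed)
  then show "x \<otimes>\<^bsub>Z\<^esub> a \<in> K" "a \<otimes>\<^bsub>Z\<^esub> x \<in> K" by auto
qed

interpretation K: ideal K Z
  by (rule ideal_tensor_kernel)

lemma ring_tensor_ring: "ring T"
  unfolding tensor_ring_def by (rule K.quotient_is_ring)

interpretation T: ring T
  by (rule ring_tensor_ring)

lemma proj_ring_hom: "(+>\<^bsub>Z\<^esub>) K \<in> ring_hom Z T"
  unfolding tensor_ring_def by (rule K.rcos_ring_hom)

lemma pure_closed [simp, intro]:
  "a \<in> carrier A \<Longrightarrow> b \<in> carrier B \<Longrightarrow> pure a b \<in> carrier T"
  unfolding pure_tensor_def by (rule ring_hom_closed[OF proj_ring_hom]) simp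

lemma coset_eq:
  assumes "Poly_Mapping.keys x \<subseteq> carrier A \<times> carrier B" "Poly_Mapping.keys y \<subseteq> carrier A \<times> carrier B"
    and "x - y \<in> K"
  shows "K +>\<^bsub>Z\<^esub> x = K +>\<^bsub>Z\<^esub> y"
proof (rule Z.a_repr_independence[OF _ _ subgroup_tensor_kernel])
  have "- (x - y) \<in> K"
    using assms(3) by (rule tensor_kernel_closed(3))
  then show "y \<in> K +>\<^bsub>Z\<^esub> x"
    by (auto simp: a_r_coset_def' intro!: bexI[of _ "y - x"])
qed (use assms in simp)

lemma pure_add_left:
  assumes "a \<in> carrier A" "a' \<in> carrier A" "b \<in> carrier B"
  shows "pure (a \<oplus>\<^bsub>A\<^esub> a') b = pure a b \<oplus>\<^bsub>T\<^esub> pure a' b"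
proof -
  have "pure (a \<oplus>\<^bsub>A\<^esub> a') b = K +>\<^bsub>Z\<^esub> (frag_of (a, b) + frag_of (a', b))"
    unfolding pure_tensor_def
  proof (rule coset_eq)
    have "frag_of (a \<oplus>\<^bsub>A\<^esub> a', b) - frag_of (a, b) - frag_of (a', b) \<in> K"
      unfolding tensor_kernel_def
      using assms by (intro generate.incl biadditive_relsI)
    then show "frag_of (a \<oplus>\<^bsub>A\<^esub> a', b) - (frag_of (a, b) + frag_of (a', b)) \<in> K"
      by (simp add: diff_diff_eq)
  qed (use assms in \<open>simp_all add: keys_add_subset\<close>)
  also have "\<dots> = pure a b \<oplus>\<^bsub>T\<^esub> pure a' b"
    using ring_hom_add[OF proj_ring_hom, of "frag_of (a, b)" "frag_of (a', b)"] assms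
    by (simp add: pure_tensor_def)
  finally show ?thesis .
qed

lemma pure_add_right:
  assumes "a \<in> carrier A" "b \<in> carrier B" "b' \<in> carrier B"
  shows "pure a (b \<oplus>\<^bsub>B\<^esub> b') = pure a b \<oplus>\<^bsub>T\<^esub> pure a b'"
proof -
  have "pure a (b \<oplus>\<^bsub>B\<^esub> b') = K +>\<^bsub>Z\<^esub> (frag_of (a, b) + frag_of (a, b'))"
    unfolding pure_tensor_def
  proof (rule coset_eq)
    have "frag_of (a, b \<oplus>\<^bsub>B\<^esub> b') - frag_of (a, b) - frag_of (a, b') \<in> K"
      unfolding tensor_kernel_def
      using assms by (intro generate.incl biadditive_relsI)
    then show "frag_of (a, b \<oplus>\<^bsub>B\<^esub> b') - (frag_of (a, b) + frag_of (a, b')) \<in> K"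
      by (simp add: diff_diff_eq)
  qed (use assms in \<open>simp_all add: keys_add_subset\<close>)
  also have "\<dots> = pure a b \<oplus>\<^bsub>T\<^esub> pure a b'"
    using ring_hom_add[OF proj_ring_hom, of "frag_of (a, b)" "frag_of (a, b')"] assms
    by (simp add: pure_tensor_def)
  finally show ?thesis .
qed

lemma pure_mult:
  assumes "a \<in> carrier A" "a' \<in> carrier A" "b \<in> carrier B" "b' \<in> carrier B"
  shows "pure a b \<otimes>\<^bsub>T\<^esub> pure a' b' = pure (a \<otimes>\<^bsub>A\<^esub> a') (b \<otimes>\<^bsub>B\<^esub> b')"
  using ring_hom_mult[OF proj_ring_hom, of "frag_of (a, b)" "frag_of (a', b')"] assms
  by (simp add: pure_tensor_def)

lemma one_tensor_ring: "\<one>\<^bsub>T\<^esub> = pure \<one>\<^bsub>A\<^esub> \<one>\<^bsub>B\<^esub>"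
  using ring_hom_one[OF proj_ring_hom] by (simp add: pure_tensor_def one_int_monoid_ring)

lemma biadditive_pure: "biadditive A B T (\<lambda>(a, b). pure a b)"
  by (rule biadditiveI) (auto simp: pure_add_left pure_add_right)

lemma pure_zero_left: "b \<in> carrier B \<Longrightarrow> pure \<zero>\<^bsub>A\<^esub> b = \<zero>\<^bsub>T\<^esub>"
  and pure_minus_left: "a \<in> carrier A \<Longrightarrow> b \<in> carrier B \<Longrightarrow> pure (\<ominus>\<^bsub>A\<^esub> a) b = \<ominus>\<^bsub>T\<^esub> pure a b"
  and pure_minus_right: "a \<in> carrier A \<Longrightarrow> b \<in> carrier B \<Longrightarrow> pure a (\<ominus>\<^bsub>B\<^esub> b) = \<ominus>\<^bsub>T\<^esub> pure a b"
proof -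
  have l: "(\<lambda>a. pure a b) \<in> hom (add_monoid A) (add_monoid T)" if "b \<in> carrier B" for b
    using biadditive_pure that by (simp add: biadditive_def)
  have r: "(\<lambda>b. pure a b) \<in> hom (add_monoid B) (add_monoid T)" if "a \<in> carrier A" for a
    using biadditive_pure that by (simp add: biadditive_def)
  show "b \<in> carrier B \<Longrightarrow> pure \<zero>\<^bsub>A\<^esub> b = \<zero>\<^bsub>T\<^esub>"
    by (rule add_hom_zero[OF A.is_abelian_group T.is_abelian_group l])
  show "a \<in> carrier A \<Longrightarrow> b \<in> carrier B \<Longrightarrow> pure (\<ominus>\<^bsub>A\<^esub> a) b = \<ominus>\<^bsub>T\<^esub> pure a b"
    by (rule add_hom_a_inv[OF A.is_abelian_group T.is_abelian_group l])
  show "a \<in> carrier A \<Longrightarrow> b \<in> carrier B \<Longrightarrow> pure a (\<ominus>\<^bsub>B\<^esub> b) = \<ominus>\<^bsub>T\<^esub> pure a b"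
    by (rule add_hom_a_inv[OF B.is_abelian_group T.is_abelian_group r])
qed

text \<open>Pure tensors span under addition alone: 0 is 0 \<otimes> 0, and -(a \<otimes> b) is (-a)
  \<otimes> b, so neither zero nor negation needs a case of its own.\<close>

lemma tensor_induct [consumes 1, case_names pure add]:
  assumes X: "X \<in> carrier T"
    and pure: "\<And>a b. a \<in> carrier A \<Longrightarrow> b \<in> carrier B \<Longrightarrow> P (pure a b)"
    and add: "\<And>X Y. X \<in> carrier T \<Longrightarrow> Y \<in> carrier T \<Longrightarrow> P X \<Longrightarrow> P Y \<Longrightarrow> P (X \<oplus>\<^bsub>T\<^esub> Y)"
  shows "P X"
proof -
  obtain x where x: "Poly_Mapping.keys x \<subseteq> carrier A \<times> carrier B" and X': "X = K +>\<^bsub>Z\<^esub> x"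
    using X unfolding tensor_ring_def by (auto elim: K.FactRing_cases)
  have coset_add: "K +>\<^bsub>Z\<^esub> (p + q) = (K +>\<^bsub>Z\<^esub> p) \<oplus>\<^bsub>T\<^esub> (K +>\<^bsub>Z\<^esub> q)"
    if "Poly_Mapping.keys p \<subseteq> carrier A \<times> carrier B" "Poly_Mapping.keys q \<subseteq> carrier A \<times> carrier B"
    for p q
    using ring_hom_add[OF proj_ring_hom, of p q] that by simp
  have coset_closed: "K +>\<^bsub>Z\<^esub> p \<in> carrier T"
    if "Poly_Mapping.keys p \<subseteq> carrier A \<times> carrier B" for p
    using ring_hom_closed[OF proj_ring_hom, of p] that by simp
  \<comment> \<open>Formal sums are built by differences, but \<open>P\<close> is only closed under
    sums. Proving \<open>P\<close> for a coset and its negative together makes the difference step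
    go through.\<close>
  from x have "P (K +>\<^bsub>Z\<^esub> x) \<and> P (K +>\<^bsub>Z\<^esub> (- x))"
  proof (induction rule: frag_induct_subset)
    case zero
    have "K +>\<^bsub>Z\<^esub> 0 = \<zero>\<^bsub>T\<^esub>"
      using ring_hom_zero[OF proj_ring_hom Z.ring_axioms T.ring_axioms] by simp
    then show ?case
      using pure[of "\<zero>\<^bsub>A\<^esub>" "\<zero>\<^bsub>B\<^esub>"] by (simp add: pure_zero_left)
  next
    case (one p)
    then obtain a b where p: "p = (a, b)" "a \<in> carrier A" "b \<in> carrier B" by auto
    have "K +>\<^bsub>Z\<^esub> (- frag_of p) = \<ominus>\<^bsub>T\<^esub> pure a b"
      using add_hom_a_inv[OF Z.is_abelian_group T.is_abelian_group
          ring_hom_in_hom(2)[OF proj_ring_hom], of "frag_of p"] p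
      by (simp add: M.minus_int_monoid_ring pure_tensor_def)
    then show ?case
      using p pure[of a b] pure[of "\<ominus>\<^bsub>A\<^esub> a" b]
      by (simp add: pure_minus_left) (simp add: pure_tensor_def)
  next
    case (diff p q)
    then have "P (K +>\<^bsub>Z\<^esub> (p + (- q)))" "P (K +>\<^bsub>Z\<^esub> (q + (- p)))"
      using diff by (auto simp: coset_add coset_closed simp del: add_uminus_conv_diff intro!: add)
    then show ?case by simp
  qed
  then show ?thesis using X' by simp
qed

text \<open>For additive \<open>f\<close> both sides of multiplicativity are biadditive, and the
  pure tensors span.\<close>

lemma tensor_ring_homI:
  assumes C: "ring C" and f: "f \<in> hom (add_monoid T) (add_monoid C)"
    and mult: "\<And>a b a' b'. a \<in> carrier A \<Longrightarrow> b \<in> carrier B \<Longrightarrow> a' \<in> carrier A \<Longrightarrow> b' \<in> carrier B \<Longrightarrow>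
      f (pure (a \<otimes>\<^bsub>A\<^esub> a') (b \<otimes>\<^bsub>B\<^esub> b')) = f (pure a b) \<otimes>\<^bsub>C\<^esub> f (pure a' b')"
    and one: "f (pure \<one>\<^bsub>A\<^esub> \<one>\<^bsub>B\<^esub>) = \<one>\<^bsub>C\<^esub>"
  shows "f \<in> ring_hom T C"
proof -
  interpret C: ring C by (rule C)
  note [simp] = add_hom_closed[OF f] add_hom_add[OF f]
  show ?thesis
  proof (rule ring_hom_memI)
    fix X Y assume X: "X \<in> carrier T" and Y: "Y \<in> carrier T"
    from X show "f (X \<otimes>\<^bsub>T\<^esub> Y) = f X \<otimes>\<^bsub>C\<^esub> f Y"
    proof (induction rule: tensor_induct)
      case (pure a b)
      from Y show ?case
        by (induction rule: tensor_induct) (simp_all add: pure pure_mult mult T.r_distr C.r_distr)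
    qed (simp add: Y T.l_distr C.l_distr)
  qed (simp_all add: one one_tensor_ring)
qed

text \<open>A biadditivity relation is sent to u + v - u - v. This gives the well-definedness of
  \<open>tensor_lift\<close>.\<close>

lemma linear_extension_tensor_kernel:
  assumes C: "abelian_group C" and f: "biadditive A B C f" and x: "x \<in> K"
  shows "linear_extension C f x = \<zero>\<^bsub>C\<^esub>"
proof -
  interpret C: abelian_group C by (rule C)
  have f_closed: "f (a, b) \<in> carrier C" if "a \<in> carrier A" "b \<in> carrier B" for a b
    using f that by (auto simp: biadditive_def hom_def)
  have h: "linear_extension C f \<in> hom (add_monoid Z) (add_monoid C)"
    by (rule C.linear_extension_add_hom) (auto simp: f_closed)
  have diff: "linear_extension C f (p - q) = linear_extension C f p \<ominus>\<^bsub>C\<^esub> linear_extension C f q"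
    if "Poly_Mapping.keys p \<subseteq> carrier A \<times> carrier B" "Poly_Mapping.keys q \<subseteq> carrier A \<times> carrier B" for p q
    using add_hom_minus[OF Z.is_abelian_group C h, of p q] that
    by (simp add: M.diff_int_monoid_ring)
  have zero: "linear_extension C f 0 = \<zero>\<^bsub>C\<^esub>"
    using add_hom_zero[OF Z.is_abelian_group C h] by simp
  have cancel: "u \<oplus>\<^bsub>C\<^esub> v \<ominus>\<^bsub>C\<^esub> u \<ominus>\<^bsub>C\<^esub> v = \<zero>\<^bsub>C\<^esub>" if "u \<in> carrier C" "v \<in> carrier C" for u v
    using that C.r_neg[of "u \<oplus>\<^bsub>C\<^esub> v"] by (simp add: a_minus_def C.minus_add C.a_assoc)
  have rel: "linear_extension C f r = \<zero>\<^bsub>C\<^esub>" if r: "r \<in> biadditive_rels A B" for r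
  proof -
    from r consider
      a a' b where "r = frag_of (a \<oplus>\<^bsub>A\<^esub> a', b) - frag_of (a, b) - frag_of (a', b)"
        "a \<in> carrier A" "a' \<in> carrier A" "b \<in> carrier B"
    | a b b' where "r = frag_of (a, b \<oplus>\<^bsub>B\<^esub> b') - frag_of (a, b) - frag_of (a, b')"
        "a \<in> carrier A" "b \<in> carrier B" "b' \<in> carrier B"
      unfolding biadditive_rels_def by blast
    then show ?thesis
    proof cases
      case 1
      moreover have "f (a \<oplus>\<^bsub>A\<^esub> a', b) = f (a, b) \<oplus>\<^bsub>C\<^esub> f (a', b)"
        using f 1 by (auto simp: biadditive_def hom_def)
      ultimately show ?thesis
        by (simp add: diff keys_diff_subset f_closed cancel)
    next
      case 2
      moreover have "f (a, b \<oplus>\<^bsub>B\<^esub> b') = f (a, b) \<oplus>\<^bsub>C\<^esub> f (a, b')"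
        using f 2 by (auto simp: biadditive_def hom_def)
      ultimately show ?thesis
        by (simp add: diff keys_diff_subset f_closed cancel)
    qed
  qed
  from x show ?thesis
  proof (induction rule: tensor_kernel_induct)
    case (minus r)
    then show ?case
      using diff[of 0 r] biadditive_rels_subset by (auto simp: rel zero a_minus_def)
  next
    case (add p q)
    then show ?case
      using add_hom_add[OF h, of p q] by (simp add: tensor_kernel_closed(5))
  qed (simp_all add: rel zero)
qed

lemma tensor_lift_add_hom:
  assumes C: "abelian_group C" and f: "biadditive A B C f"
  shows "tensor_lift C f \<in> hom (add_monoid T) (add_monoid C)"
    and "a \<in> carrier A \<Longrightarrow> b \<in> carrier B \<Longrightarrow> tensor_lift C f (pure a b) = f (a, b)"
proof -
  interpret C: abelian_group C by (rule C)
  have f_closed: "f (a, b) \<in> carrier C" if "a \<in> carrier A" "b \<in> carrier B" for a b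
    using f that by (auto simp: biadditive_def hom_def)
  have h: "linear_extension C f \<in> hom (add_monoid Z) (add_monoid C)"
    by (rule C.linear_extension_add_hom) (auto simp: f_closed)
  note lift = K.quotient_lift_add_hom[OF C h linear_extension_tensor_kernel[OF C f]]
  show "tensor_lift C f \<in> hom (add_monoid T) (add_monoid C)"
    using lift(1) by (simp add: tensor_lift_def[abs_def] tensor_ring_def)
  show "a \<in> carrier A \<Longrightarrow> b \<in> carrier B \<Longrightarrow> tensor_lift C f (pure a b) = f (a, b)"
    using lift(2)[of "frag_of (a, b)"] by (simp add: tensor_lift_def pure_tensor_def f_closed)
qed

end

section \<open>Functoriality and associativity of the tensor product\<close>

lemma tensor_map_add_hom:
  assumes "ring A" "ring B" "ring C" "ring D"
    and f: "f \<in> hom (add_monoid A) (add_monoid C)" and g: "g \<in> hom (add_monoid B) (add_monoid D)"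
  shows "tensor_map C D f g \<in> hom (add_monoid (tensor_ring A B)) (add_monoid (tensor_ring C D))"
    and "a \<in> carrier A \<Longrightarrow> b \<in> carrier B \<Longrightarrow>
      tensor_map C D f g (pure_tensor A B a b) = pure_tensor C D (f a) (g b)"
proof -
  interpret AB: two_rings A B by (intro two_rings.intro assms)
  interpret CD: two_rings C D by (intro two_rings.intro assms)
  have "biadditive A B CD.T (\<lambda>(a, b). CD.pure (f a) (g b))"
    by (rule biadditiveI)
      (auto simp: add_hom_add[OF f] add_hom_add[OF g] add_hom_closed[OF f] add_hom_closed[OF g]
        CD.pure_add_left CD.pure_add_right)
  from AB.tensor_lift_add_hom[OF ring.is_abelian_group[OF CD.ring_tensor_ring] this]
  show "tensor_map C D f g \<in> hom (add_monoid AB.T) (add_monoid CD.T)"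
    and "a \<in> carrier A \<Longrightarrow> b \<in> carrier B \<Longrightarrow> tensor_map C D f g (AB.pure a b) = CD.pure (f a) (g b)"
    by (simp_all add: tensor_map_def)
qed

lemma tensor_map_ring_hom:
  assumes "ring A" "ring B" "ring C" "ring D" and f: "f \<in> ring_hom A C" and g: "g \<in> ring_hom B D"
  shows "tensor_map C D f g \<in> ring_hom (tensor_ring A B) (tensor_ring C D)"
proof -
  interpret AB: two_rings A B by (intro two_rings.intro assms)
  interpret CD: two_rings C D by (intro two_rings.intro assms)
  note h = tensor_map_add_hom[OF assms(1-4) ring_hom_in_hom(2)[OF f] ring_hom_in_hom(2)[OF g]]
  show ?thesis
    by (rule AB.tensor_ring_homI[OF CD.ring_tensor_ring h(1)])
      (simp_all add: h(2) ring_hom_mult[OF f] ring_hom_mult[OF g] ring_hom_one[OF f] ring_hom_one[OF g]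
        ring_hom_closed[OF f] ring_hom_closed[OF g] CD.pure_mult CD.one_tensor_ring)
qed

lemma tensor_assoc_ring_hom:
  assumes "ring A" "ring B" "ring C"
  shows "tensor_assoc A B C \<in>
      ring_hom (tensor_ring (tensor_ring A B) C) (tensor_ring A (tensor_ring B C))"
    and "a \<in> carrier A \<Longrightarrow> b \<in> carrier B \<Longrightarrow> c \<in> carrier C \<Longrightarrow>
      tensor_assoc A B C (pure_tensor (tensor_ring A B) C (pure_tensor A B a b) c) =
      pure_tensor A (tensor_ring B C) a (pure_tensor B C b c)"
proof -
  interpret AB: two_rings A B by (intro two_rings.intro assms)
  interpret BC: two_rings B C by (intro two_rings.intro assms)
  interpret AB_C: two_rings AB.T C by (intro two_rings.intro assms AB.ring_tensor_ring)
  interpret A_BC: two_rings A BC.T by (intro two_rings.intro assms BC.ring_tensor_ring)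
  interpret T: ring A_BC.T by (rule A_BC.ring_tensor_ring)
  \<comment> \<open>This is the inner lift of \<open>tensor_assoc\<close> with the third factor held
    fixed. It is additive in its tensor argument by construction; additivity in \<open>c\<close> and
    multiplicativity in both arguments together need an induction over tensors.\<close>
  define \<phi> where "\<phi> = (\<lambda>c. tensor_lift A_BC.T (\<lambda>(a, b). A_BC.pure a (BC.pure b c)))"
  have bi: "biadditive A B A_BC.T (\<lambda>(a, b). A_BC.pure a (BC.pure b c))" if "c \<in> carrier C" for c
    using that by (intro biadditiveI)
      (auto simp: A_BC.pure_add_left A_BC.pure_add_right BC.pure_add_left)
  have \<phi>: "\<phi> c \<in> hom (add_monoid AB.T) (add_monoid A_BC.T)"
    and \<phi>_pure: "\<And>a b. a \<in> carrier A \<Longrightarrow> b \<in> carrier B \<Longrightarrow>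
      \<phi> c (AB.pure a b) = A_BC.pure a (BC.pure b c)"
    if "c \<in> carrier C" for c
    using AB.tensor_lift_add_hom[OF T.is_abelian_group bi[OF that]] by (simp_all add: \<phi>_def)
  note [simp] = add_hom_closed[OF \<phi>] add_hom_add[OF \<phi>]
  have \<phi>_add: "\<phi> (c \<oplus>\<^bsub>C\<^esub> c') X = \<phi> c X \<oplus>\<^bsub>A_BC.T\<^esub> \<phi> c' X"
    if "X \<in> carrier AB.T" "c \<in> carrier C" "c' \<in> carrier C" for X c c'
    using that(1)
    by (induction rule: AB.tensor_induct)
      (simp_all add: that \<phi>_pure BC.pure_add_right A_BC.pure_add_right T.a_ac)
  have \<phi>_mult: "\<phi> (c \<otimes>\<^bsub>C\<^esub> c') (X \<otimes>\<^bsub>AB.T\<^esub> Y) = \<phi> c X \<otimes>\<^bsub>A_BC.T\<^esub> \<phi> c' Y"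
    if "X \<in> carrier AB.T" "Y \<in> carrier AB.T" and c: "c \<in> carrier C" "c' \<in> carrier C" for X Y c c'
    using that(1)
  proof (induction rule: AB.tensor_induct)
    case (pure a b)
    from that(2) show ?case
      by (induction rule: AB.tensor_induct)
        (simp_all add: c pure AB.pure_mult BC.pure_mult A_BC.pure_mult \<phi>_pure AB_C.A.r_distr T.r_distr)
  qed (simp add: that AB_C.A.l_distr T.l_distr)
  have "biadditive AB.T C A_BC.T (\<lambda>(X, c). \<phi> c X)"
    by (rule biadditiveI) (auto simp: \<phi>_add)
  from AB_C.tensor_lift_add_hom[OF T.is_abelian_group this]
  have hom: "tensor_assoc A B C \<in> hom (add_monoid AB_C.T) (add_monoid A_BC.T)"
    and pure: "\<And>X c. X \<in> carrier AB.T \<Longrightarrow> c \<in> carrier C \<Longrightarrow> tensor_assoc A B C (AB_C.pure X c) = \<phi> c X"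
    by (simp_all add: tensor_assoc_def \<phi>_def)
  show "tensor_assoc A B C \<in> ring_hom AB_C.T A_BC.T"
    by (rule AB_C.tensor_ring_homI[OF T.ring_axioms hom])
      (simp_all add: pure \<phi>_mult, simp add: \<phi>_pure AB.one_tensor_ring A_BC.one_tensor_ring BC.one_tensor_ring)
  show "tensor_assoc A B C (AB_C.pure (AB.pure a b) c) = A_BC.pure a (BC.pure b c)"
    if "a \<in> carrier A" "b \<in> carrier B" "c \<in> carrier C"
    using that by (simp add: pure \<phi>_pure)
qed

section \<open>Tensoring with the integers, and the multiplication map\<close>

lemma ring_int_ring: "ring \<Z>"
  by (rule int.ring_axioms)

context ring
begin

lemma add_pow_int_zero: "[(0 :: int)] \<cdot> x = \<zero>"
  by (simp add: add_pow_def)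

lemma add_pow_int_closed: "x \<in> carrier R \<Longrightarrow> [(k :: int)] \<cdot> x \<in> carrier R"
  by (rule add.int_pow_closed)

text \<open>Integer multiples of 1 are central, which is why \<open>tensor_lunit\<close> and
  \<open>tensor_runit\<close> are multiplicative.\<close>

lemma add_pow_int_mult:
  assumes "x \<in> carrier R" "y \<in> carrier R"
  shows "([(k :: int)] \<cdot> x) \<otimes> ([(l :: int)] \<cdot> y) = [(k * l)] \<cdot> (x \<otimes> y)"
  using assms
  by (simp add: add_pow_ldistr_int add_pow_rdistr_int add_pow_int_closed add.int_pow_pow mult.commute)

lemma tensor_lunit_ring_hom:
  shows "tensor_lunit R \<in> ring_hom (tensor_ring \<Z> R) R"
    and "x \<in> carrier R \<Longrightarrow> tensor_lunit R (pure_tensor \<Z> R k x) = [k] \<cdot> x"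
proof -
  interpret ZR: two_rings \<Z> R by (intro two_rings.intro ring_int_ring ring_axioms)
  have "biadditive \<Z> R R (\<lambda>(k, a). [k] \<cdot> a)"
    by (rule biadditiveI) (auto simp: add_pow_int_closed add.int_pow_mult add.int_pow_distrib)
  note lift = ZR.tensor_lift_add_hom[OF is_abelian_group this, folded tensor_lunit_def]
  show "x \<in> carrier R \<Longrightarrow> tensor_lunit R (pure_tensor \<Z> R k x) = [k] \<cdot> x"
    by (simp add: lift(2))
  show "tensor_lunit R \<in> ring_hom (tensor_ring \<Z> R) R"
    by (rule ZR.tensor_ring_homI[OF ring_axioms lift(1)])
      (simp_all add: lift(2) add_pow_int_mult)
qed

lemma tensor_runit_ring_hom:
  shows "tensor_runit R \<in> ring_hom (tensor_ring R \<Z>) R"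
    and "x \<in> carrier R \<Longrightarrow> tensor_runit R (pure_tensor R \<Z> x k) = [k] \<cdot> x"
proof -
  interpret RZ: two_rings R \<Z> by (intro two_rings.intro ring_int_ring ring_axioms)
  have "biadditive R \<Z> R (\<lambda>(a, k). [k] \<cdot> a)"
    by (rule biadditiveI) (auto simp: add_pow_int_closed add.int_pow_mult add.int_pow_distrib)
  note lift = RZ.tensor_lift_add_hom[OF is_abelian_group this, folded tensor_runit_def]
  show "x \<in> carrier R \<Longrightarrow> tensor_runit R (pure_tensor R \<Z> x k) = [k] \<cdot> x"
    by (simp add: lift(2))
  show "tensor_runit R \<in> ring_hom (tensor_ring R \<Z>) R"
    by (rule RZ.tensor_ring_homI[OF ring_axioms lift(1)])
      (simp_all add: lift(2) add_pow_int_mult)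
qed

text \<open>Additivity is all that can be expected: multiplicativity would say a a' b b' = a b a' b'
  and so force the ring to be commutative.\<close>

lemma tensor_mult_add_hom:
  shows "tensor_mult R \<in> hom (add_monoid (tensor_ring R R)) (add_monoid R)"
    and "x \<in> carrier R \<Longrightarrow> y \<in> carrier R \<Longrightarrow> tensor_mult R (pure_tensor R R x y) = x \<otimes> y"
proof -
  interpret RR: two_rings R R by (intro two_rings.intro ring_axioms)
  have "biadditive R R R (\<lambda>(a, b). a \<otimes> b)"
    by (rule biadditiveI) (auto simp: l_distr r_distr)
  note lift = RR.tensor_lift_add_hom[OF is_abelian_group this, folded tensor_mult_def]
  show "tensor_mult R \<in> hom (add_monoid (tensor_ring R R)) (add_monoid R)"
    and "x \<in> carrier R \<Longrightarrow> y \<in> carrier R \<Longrightarrow> tensor_mult R (pure_tensor R R x y) = x \<otimes> y"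
    by (rule lift(1)) (simp add: lift(2))
qed

end

section \<open>The presentation of \<open>H(S\<^sub>n)\<close>\<close>

text \<open>A realisation of the presentation in an arbitrary ring. It serves both as the hypothesis
  of the universal property and as the setting of all calculations with the relations.\<close>

locale hecke_hopf_family = ring R for R (structure) +
  fixes s D :: "nat \<Rightarrow> 'a" and n :: nat
  assumes s_closed [simp]: "i \<in> {1..n-1} \<Longrightarrow> s i \<in> carrier R"
    and D_closed [simp]: "i \<in> {1..n-1} \<Longrightarrow> D i \<in> carrier R"
    and rel: "hecke_hopf_rel R s D n l r \<Longrightarrow> l = r"

section \<open>Transport of the relations along a ring homomorphism\<close>

context ring_hom_ring
begin

lemma hom_minus: "x \<in> carrier R \<Longrightarrow> y \<in> carrier R \<Longrightarrow> h (x \<ominus>\<^bsub>R\<^esub> y) = h x \<ominus>\<^bsub>S\<^esub> h y"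
  by (simp add: a_minus_def)

context
  fixes s D :: "nat \<Rightarrow> 'a" and n :: nat
  assumes s: "\<And>i. i \<in> {1..n-1} \<Longrightarrow> s i \<in> carrier R"
    and D: "\<And>i. i \<in> {1..n-1} \<Longrightarrow> D i \<in> carrier R"
begin

lemma hecke_hopf_rel_closed:
  assumes "hecke_hopf_rel R s D n l r"
  shows "l \<in> carrier R \<and> r \<in> carrier R"
  using assms by cases (auto simp: s D)

lemma hecke_hopf_rel_hom:
  assumes "hecke_hopf_rel R s D n l r"
  shows "hecke_hopf_rel S (\<lambda>i. h (s i)) (\<lambda>i. h (D i)) n (h l) (h r)"
  using assms
proof cases
  case (s_sq i)
  then show ?thesis using hecke_hopf_rel.s_sq[of i n S "\<lambda>i. h (s i)" "\<lambda>i. h (D i)"] by (simp add: s D)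
next
  case (s_D i)
  then show ?thesis using hecke_hopf_rel.s_D[of i n S "\<lambda>i. h (s i)" "\<lambda>i. h (D i)"]
    by (simp add: s D hom_minus)
next
  case (D_sq i)
  then show ?thesis using hecke_hopf_rel.D_sq[of i n S "\<lambda>i. h (s i)" "\<lambda>i. h (D i)"] by (simp add: s D)
next
  case (far_ss i j)
  then show ?thesis using hecke_hopf_rel.far_ss[of i n j S "\<lambda>i. h (s i)" "\<lambda>i. h (D i)"] by (simp add: s D)
next
  case (far_Ds i j)
  then show ?thesis using hecke_hopf_rel.far_Ds[of i n j S "\<lambda>i. h (s i)" "\<lambda>i. h (D i)"] by (simp add: s D)
next
  case (far_DD i j)
  then show ?thesis using hecke_hopf_rel.far_DD[of i n j S "\<lambda>i. h (s i)" "\<lambda>i. h (D i)"] by (simp add: s D)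
next
  case (braid_sss i j)
  then show ?thesis using hecke_hopf_rel.braid_sss[of i n j S "\<lambda>i. h (s i)" "\<lambda>i. h (D i)"] by (simp add: s D)
next
  case (braid_Dss i j)
  then show ?thesis using hecke_hopf_rel.braid_Dss[of i n j S "\<lambda>i. h (s i)" "\<lambda>i. h (D i)"] by (simp add: s D)
next
  case (braid_DsD i j)
  then show ?thesis using hecke_hopf_rel.braid_DsD[of i n j S "\<lambda>i. h (s i)" "\<lambda>i. h (D i)"] by (simp add: s D)
qed

text \<open>Used for the quotient map: every instance of a relation between the images comes from an
  instance in the free ring, where membership in the ideal can be invoked.\<close>

lemma hecke_hopf_rel_hom_lift:
  assumes "hecke_hopf_rel S (\<lambda>i. h (s i)) (\<lambda>i. h (D i)) n l' r'"
  shows "\<exists>l r. hecke_hopf_rel R s D n l r \<and> l' = h l \<and> r' = h r"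
  using assms
proof cases
  case (s_sq i)
  show ?thesis
    by (rule exI, rule exI, rule conjI, rule hecke_hopf_rel.s_sq[of i])
      (use s_sq in \<open>simp_all add: s D\<close>)
next
  case (s_D i)
  show ?thesis
    by (rule exI, rule exI, rule conjI, rule hecke_hopf_rel.s_D[of i])
      (use s_D in \<open>simp_all add: s D hom_minus\<close>)
next
  case (D_sq i)
  show ?thesis
    by (rule exI, rule exI, rule conjI, rule hecke_hopf_rel.D_sq[of i])
      (use D_sq in \<open>simp_all add: s D\<close>)
next
  case (far_ss i j)
  show ?thesis
    by (rule exI, rule exI, rule conjI, rule hecke_hopf_rel.far_ss[of i _ j])
      (use far_ss in \<open>simp_all add: s D\<close>)
next
  case (far_Ds i j)
  show ?thesis
    by (rule exI, rule exI, rule conjI, rule hecke_hopf_rel.far_Ds[of i _ j])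
      (use far_Ds in \<open>simp_all add: s D\<close>)
next
  case (far_DD i j)
  show ?thesis
    by (rule exI, rule exI, rule conjI, rule hecke_hopf_rel.far_DD[of i _ j])
      (use far_DD in \<open>simp_all add: s D\<close>)
next
  case (braid_sss i j)
  show ?thesis
    by (rule exI, rule exI, rule conjI, rule hecke_hopf_rel.braid_sss[of i _ j])
      (use braid_sss in \<open>simp_all add: s D\<close>)
next
  case (braid_Dss i j)
  show ?thesis
    by (rule exI, rule exI, rule conjI, rule hecke_hopf_rel.braid_Dss[of i _ j])
      (use braid_Dss in \<open>simp_all add: s D\<close>)
next
  case (braid_DsD i j)
  show ?thesis
    by (rule exI, rule exI, rule conjI, rule hecke_hopf_rel.braid_DsD[of i _ j])
      (use braid_DsD in \<open>simp_all add: s D\<close>)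
qed

end

end

section \<open>Free rings: universal property and generation\<close>

lemma monoid_free_monoid: "monoid (free_monoid V)"
  by (rule monoidI) (auto simp: free_monoid_def)

lemma ring_free_ring: "ring (free_ring V)"
  unfolding free_ring_def by (intro monoid.ring_int_monoid_ring monoid_free_monoid)

lemma free_gen_closed: "x \<in> V \<Longrightarrow> free_gen x \<in> carrier (free_ring V)"
  by (simp add: free_ring_def free_gen_def free_monoid_def)

text \<open>Multiplying out the letters of a word is a monoid homomorphism, and its linear extension
  is the required map.\<close>

lemma (in ring) free_ring_universal:
  assumes f: "f \<in> V \<rightarrow> carrier R"
  obtains \<phi> where "\<phi> \<in> ring_hom (free_ring V) R" "\<And>x. x \<in> V \<Longrightarrow> \<phi> (free_gen x) = f x"
proof
  define ev where "ev = (\<lambda>w. foldr (\<lambda>x y. f x \<otimes> y) w \<one>)"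
  have f_closed: "f x \<in> carrier R" if "x \<in> V" for x
    using f that by auto
  have closed: "ev w \<in> carrier R" if "w \<in> lists V" for w
    using that by (induction w) (auto simp: ev_def f_closed)
  have append: "ev (u @ v) = ev u \<otimes> ev v" if "u \<in> lists V" "v \<in> lists V" for u v
    using that(1) by (induction u) (use closed that(2) in \<open>auto simp: ev_def f_closed m_assoc\<close>)
  show "linear_extension R ev \<in> ring_hom (free_ring V) R"
    unfolding free_ring_def
    by (rule linear_extension_ring_hom[OF monoid_free_monoid])
      (auto simp: free_monoid_def hom_def closed append, simp add: ev_def)
  show "linear_extension R ev (free_gen x) = f x" if "x \<in> V" for x
    using that by (simp add: free_gen_def ev_def f_closed)
qed

lemma carrier_free_ring: "carrier (free_ring V) = generate_ring (free_ring V) (free_gen ` V)"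
proof
  interpret F: ring "free_ring V" by (rule ring_free_ring)
  interpret W: monoid "free_monoid V" by (rule monoid_free_monoid)
  let ?G = "generate_ring (free_ring V) (free_gen ` V)"
  have one: "\<one>\<^bsub>free_ring V\<^esub> = frag_of []"
    by (simp add: free_ring_def free_monoid_def one_int_monoid_ring)
  have word: "frag_of w \<in> ?G" if "w \<in> lists V" for w
    using that
  proof (induction w)
    case Nil
    then show ?case using generate_ring.one[of "free_ring V"] by (simp add: one)
  next
    case (Cons x w)
    have "free_gen x \<otimes>\<^bsub>free_ring V\<^esub> frag_of w \<in> ?G"
      using Cons by (intro generate_ring.eng_mult[OF generate_ring.incl]) auto
    then show ?case
      by (simp add: free_gen_def free_ring_def free_monoid_def)
  qed
  have sub: "?G \<subseteq> carrier (free_ring V)"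
    by (intro F.generate_ring_incl) (auto simp: free_gen_closed)
  have minus: "\<ominus>\<^bsub>free_ring V\<^esub> p = - p" if "Poly_Mapping.keys p \<subseteq> lists V" for p
    using W.minus_int_monoid_ring[of p] that by (simp add: free_ring_def free_monoid_def)
  show "carrier (free_ring V) \<subseteq> ?G"
  proof
    fix p assume "p \<in> carrier (free_ring V)"
    then have "Poly_Mapping.keys p \<subseteq> lists V"
      by (simp add: free_ring_def free_monoid_def)
    then show "p \<in> ?G"
    proof (induction rule: frag_induct_subset)
      case zero
      \<comment> \<open>\<open>generate_ring\<close> has no clause for zero, so zero is obtained as
        1 - 1.\<close>
      have "\<one>\<^bsub>free_ring V\<^esub> \<oplus>\<^bsub>free_ring V\<^esub> (\<ominus>\<^bsub>free_ring V\<^esub> \<one>\<^bsub>free_ring V\<^esub>) \<in> ?G"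
        by (intro generate_ring.eng_add generate_ring.a_inv generate_ring.one)
      then show ?case by (simp add: F.r_neg) (simp add: free_ring_def)
    next
      case (diff p q)
      have "p \<oplus>\<^bsub>free_ring V\<^esub> (\<ominus>\<^bsub>free_ring V\<^esub> q) \<in> ?G"
        using diff by (intro generate_ring.eng_add generate_ring.a_inv)
      then show ?case using diff by (simp add: minus) (simp add: free_ring_def)
    qed (rule word)
  qed
  show "?G \<subseteq> carrier (free_ring V)" by (rule sub)
qed

lemma (in ring_hom_ring) image_generate_ring:
  assumes "X \<subseteq> carrier R" "x \<in> generate_ring R X"
  shows "h x \<in> generate_ring S (h ` X)"
  using assms(2)
proof induction
  case (a_inv x)
  then show ?case
    using R.generate_ring_in_carrier[OF assms(1)] by (auto intro: generate_ring.a_inv)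
next
  case (eng_add x y)
  then show ?case
    using R.generate_ring_in_carrier[OF assms(1)] by (auto intro: generate_ring.eng_add)
next
  case (eng_mult x y)
  then show ?case
    using R.generate_ring_in_carrier[OF assms(1)] by (auto intro: generate_ring.eng_mult)
qed (auto intro: generate_ring.intros)

section \<open>The quotient by the relations\<close>

context
  fixes n :: nat
begin

private abbreviation (input) "F \<equiv> hecke_hopf_free n"
private abbreviation (input) "I \<equiv> hecke_hopf_ideal n"
private abbreviation (input) "H \<equiv> hecke_hopf n"
private abbreviation (input) "sF \<equiv> \<lambda>i. free_gen (Gen_s i)"
private abbreviation (input) "DF \<equiv> \<lambda>i. free_gen (Gen_D i)"

interpretation F: ring F
  by (rule ring_free_ring)

private lemma sF_closed: "i \<in> {1..n-1} \<Longrightarrow> sF i \<in> carrier F"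
  by (rule free_gen_closed) (simp add: gens_def)

private lemma DF_closed: "i \<in> {1..n-1} \<Longrightarrow> DF i \<in> carrier F"
  by (rule free_gen_closed) (simp add: gens_def)

private definition "rels = {l \<ominus>\<^bsub>F\<^esub> r | l r. hecke_hopf_rel F sF DF n l r}"

private lemma rels_subset: "rels \<subseteq> carrier F"
proof -
  \<comment> \<open>The closure of the two sides of a relation was proved for the source of a
    homomorphism; the identity makes it available for the free ring itself.\<close>
  interpret id: ring_hom_ring F F id
    by (simp add: ring_hom_ring.intro ring_hom_ring_axioms.intro F.ring_axioms)
  show ?thesis
    using id.hecke_hopf_rel_closed[OF sF_closed DF_closed] by (auto simp: rels_def)
qed

private lemma ideal_eq: "I = genideal F rels"
  by (simp add: hecke_hopf_ideal_def rels_def)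

interpretation I: ideal I F
  unfolding ideal_eq by (rule F.genideal_ideal[OF rels_subset])

lemma ring_hecke_hopf: "ring H"
  unfolding hecke_hopf_def by (rule I.quotient_is_ring)

interpretation H: ring H
  by (rule ring_hecke_hopf)

interpretation proj: ring_hom_ring F H "(+>\<^bsub>F\<^esub>) I"
  unfolding hecke_hopf_def by (rule I.rcos_ring_hom_ring)

text \<open>A relation between the classes lifts to one in the free ring, and the difference of its
  sides is then a generator of the ideal.\<close>

lemma hecke_hopf_family_hecke_hopf: "hecke_hopf_family H (hh_s n) (hh_D n) n"
proof unfold_locales
  show "hh_s n i \<in> carrier H" "hh_D n i \<in> carrier H" if "i \<in> {1..n-1}" for i
    unfolding hh_s_def hh_D_def by (intro proj.hom_closed sF_closed DF_closed that)+
  fix l r assume "hecke_hopf_rel H (hh_s n) (hh_D n) n l r"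
  then obtain l' r' where rel: "hecke_hopf_rel F sF DF n l' r'"
    and l: "l = I +>\<^bsub>F\<^esub> l'" and r: "r = I +>\<^bsub>F\<^esub> r'"
    unfolding hh_s_def[abs_def] hh_D_def[abs_def]
    using proj.hecke_hopf_rel_hom_lift[where s = sF and D = DF, OF sF_closed DF_closed] by blast
  have closed: "l' \<in> carrier F" "r' \<in> carrier F"
    using proj.hecke_hopf_rel_closed[OF sF_closed DF_closed rel] by auto
  have "l' \<ominus>\<^bsub>F\<^esub> r' \<in> I"
    unfolding ideal_eq using rel by (intro subsetD[OF F.genideal_self[OF rels_subset]]) (auto simp: rels_def)
  then show "l = r"
    unfolding l r using closed by (simp add: F.quotient_eq_iff_same_a_r_cos[OF I.ideal_axioms])
qed

text \<open>The quotient map is onto and sends the free generators to the given classes.\<close>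

lemma hecke_hopf_generated: "carrier H = generate_ring H (hh_s n ` {1..n-1} \<union> hh_D n ` {1..n-1})"
proof
  interpret HF: hecke_hopf_family H "hh_s n" "hh_D n" n
    by (rule hecke_hopf_family_hecke_hopf)
  have eq: "(+>\<^bsub>F\<^esub>) I ` free_gen ` gens n = hh_s n ` {1..n-1} \<union> hh_D n ` {1..n-1}"
    by (auto simp: gens_def hh_s_def hh_D_def image_Un image_image)
  show "carrier H \<subseteq> generate_ring H (hh_s n ` {1..n-1} \<union> hh_D n ` {1..n-1})"
  proof
    fix X assume "X \<in> carrier H"
    then obtain x where x: "x \<in> carrier F" "X = I +>\<^bsub>F\<^esub> x"
      unfolding hecke_hopf_def by (rule I.FactRing_cases)
    then have "x \<in> generate_ring F (free_gen ` gens n)"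
      using carrier_free_ring by blast
    then have "X \<in> generate_ring H ((+>\<^bsub>F\<^esub>) I ` free_gen ` gens n)"
      unfolding x(2) by (intro proj.image_generate_ring) (auto intro: free_gen_closed)
    then show "X \<in> generate_ring H (hh_s n ` {1..n-1} \<union> hh_D n ` {1..n-1})"
      by (simp add: eq)
  qed
  show "generate_ring H (hh_s n ` {1..n-1} \<union> hh_D n ` {1..n-1}) \<subseteq> carrier H"
    by (rule H.generate_ring_incl) auto
qed

text \<open>The kernel of the evaluation on the free ring is a two-sided ideal containing all
  relators, hence contains the ideal they generate, and the evaluation descends.\<close>

lemma hecke_hopf_universal:
  assumes "hecke_hopf_family R s D n"
  obtains \<phi> where "\<phi> \<in> ring_hom H R" "\<And>i. i \<in> {1..n-1} \<Longrightarrow> \<phi> (hh_s n i) = s i"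
    "\<And>i. i \<in> {1..n-1} \<Longrightarrow> \<phi> (hh_D n i) = D i"
proof -
  interpret R: hecke_hopf_family R s D n by (rule assms)
  obtain \<phi> where \<phi>: "\<phi> \<in> ring_hom F R"
    and gen: "\<And>x. x \<in> gens n \<Longrightarrow> \<phi> (free_gen x) = (case x of Gen_s i \<Rightarrow> s i | Gen_D i \<Rightarrow> D i)"
    by (rule R.free_ring_universal[of "\<lambda>x. case x of Gen_s i \<Rightarrow> s i | Gen_D i \<Rightarrow> D i" "gens n"])
      (auto simp: gens_def)
  interpret \<phi>: ring_hom_ring F R \<phi>
    using \<phi> by (simp add: ring_hom_ring.intro ring_hom_ring_axioms.intro F.ring_axioms R.ring_axioms)
  have s: "\<phi> (sF i) = s i" and D: "\<phi> (DF i) = D i" if "i \<in> {1..n-1}" for i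
    using gen[of "Gen_s i"] gen[of "Gen_D i"] that by (auto simp: gens_def)
  have "\<phi> l = \<phi> r" if "hecke_hopf_rel F sF DF n l r" for l r
  proof (rule R.rel)
    have "hecke_hopf_rel R (\<lambda>i. \<phi> (sF i)) (\<lambda>i. \<phi> (DF i)) n (\<phi> l) (\<phi> r)"
      using sF_closed DF_closed that by (rule \<phi>.hecke_hopf_rel_hom)
    \<comment> \<open>The images of the free generators are known to agree with \<open>s\<close> and
      \<open>D\<close> only at indices in \<open>{1..n-1}\<close>, so the relation is taken apart
      and rebuilt case by case.\<close>
    then show "hecke_hopf_rel R s D n (\<phi> l) (\<phi> r)"
      by cases (auto simp: s D intro: hecke_hopf_rel.intros)
  qed
  then have "\<phi> (l \<ominus>\<^bsub>F\<^esub> r) = \<zero>\<^bsub>R\<^esub>" if "hecke_hopf_rel F sF DF n l r" for l r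
    using that \<phi>.hecke_hopf_rel_closed[OF sF_closed DF_closed that]
    by (simp add: \<phi>.hom_minus R.r_right_minus_eq)
  then have "\<phi> x = \<zero>\<^bsub>R\<^esub>" if "x \<in> rels" for x
    using that unfolding rels_def by blast
  then have "rels \<subseteq> a_kernel F R \<phi>"
    using rels_subset unfolding a_kernel_def' by blast
  then have "I \<subseteq> a_kernel F R \<phi>"
    unfolding ideal_eq by (intro F.genideal_minimal \<phi>.kernel_is_ideal)
  then have zero: "\<phi> x = \<zero>\<^bsub>R\<^esub>" if "x \<in> I" for x
    using that unfolding a_kernel_def' by blast
  note lift = I.quotient_lift_add_hom(2)[OF R.is_abelian_group ring_hom_in_hom(2)[OF \<phi>] zero]
  show thesis
  proof (rule that)
    show "(\<lambda>X. the_elem (\<phi> ` X)) \<in> ring_hom H R"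
      unfolding hecke_hopf_def using R.ring_axioms \<phi> zero by (rule I.quotient_lift_ring_hom)
    show "the_elem (\<phi> ` hh_s n i) = s i" "the_elem (\<phi> ` hh_D n i) = D i" if "i \<in> {1..n-1}" for i
      using that by (simp_all add: hh_s_def hh_D_def lift sF_closed DF_closed s D)
  qed
qed

end

section \<open>Hopf algebra axioms on generators\<close>

lemma opposite_ring_simps [simp]:
  "carrier (opposite_ring R) = carrier R" "\<one>\<^bsub>opposite_ring R\<^esub> = \<one>\<^bsub>R\<^esub>" "\<zero>\<^bsub>opposite_ring R\<^esub> = \<zero>\<^bsub>R\<^esub>"
  "x \<otimes>\<^bsub>opposite_ring R\<^esub> y = y \<otimes>\<^bsub>R\<^esub> x" "x \<oplus>\<^bsub>opposite_ring R\<^esub> y = x \<oplus>\<^bsub>R\<^esub> y"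
  "\<ominus>\<^bsub>opposite_ring R\<^esub> x = \<ominus>\<^bsub>R\<^esub> x" "x \<ominus>\<^bsub>opposite_ring R\<^esub> y = x \<ominus>\<^bsub>R\<^esub> y"
  by (simp_all add: opposite_ring_def a_inv_def a_minus_def)

lemma add_monoid_opposite_ring: "add_monoid (opposite_ring R) = add_monoid R"
  by (simp add: opposite_ring_def)

lemma (in ring) ring_opposite_ring: "ring (opposite_ring R)"
proof (rule ringI)
  show "abelian_group (opposite_ring R)"
    using is_abelian_group
    unfolding abelian_group_def abelian_monoid_def abelian_group_axioms_def add_monoid_opposite_ring .
  show "monoid (opposite_ring R)"
    by (rule monoidI) (auto simp: m_assoc)
qed (auto simp: l_distr r_distr)

text \<open>The elements at which two ring homomorphisms agree form a subring.\<close>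

lemma ring_hom_eq_on_generate_ring:
  assumes R: "ring R" and S: "ring S" and f: "f \<in> ring_hom R S" and g: "g \<in> ring_hom R S"
    and X: "X \<subseteq> carrier R" and eq: "\<And>x. x \<in> X \<Longrightarrow> f x = g x"
    and x: "x \<in> generate_ring R X"
  shows "f x = g x"
proof -
  note closed = ring.generate_ring_in_carrier[OF R X]
  note add = add_hom_a_inv[OF ring.is_abelian_group[OF R] ring.is_abelian_group[OF S] ring_hom_in_hom(2)]
  from x show ?thesis
    by induction
      (use closed in \<open>simp_all add: eq ring_hom_one[OF f] ring_hom_one[OF g] add[OF f] add[OF g]
        ring_hom_add[OF f] ring_hom_add[OF g] ring_hom_mult[OF f] ring_hom_mult[OF g]\<close>)
qed

lemma ident_ring_hom: "(\<lambda>x. x) \<in> ring_hom R R"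
  by (rule ring_hom_memI) auto

section \<open>Convolution with an anti-multiplicative map\<close>

context ring
begin

text \<open>\<open>conv_left S \<circ> \<Delta>\<close> and \<open>conv_right S \<circ> \<Delta>\<close> are the convolution products \<open>S * id\<close> and \<open>id * S\<close>.\<close>

definition conv_left :: "('a \<Rightarrow> 'a) \<Rightarrow> ('a \<times> 'a \<Rightarrow>\<^sub>0 int) set \<Rightarrow> 'a" where
  "conv_left S = (\<lambda>X. tensor_mult R (tensor_map R R S (\<lambda>x. x) X))"

definition conv_right :: "('a \<Rightarrow> 'a) \<Rightarrow> ('a \<times> 'a \<Rightarrow>\<^sub>0 int) set \<Rightarrow> 'a" where
  "conv_right S = (\<lambda>X. tensor_mult R (tensor_map R R (\<lambda>x. x) S X))"

context
  fixes S :: "'a \<Rightarrow> 'a"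
  assumes S: "S \<in> ring_hom R (opposite_ring R)"
begin

private abbreviation (input) "T \<equiv> tensor_ring R R"

private lemma S_closed: "x \<in> carrier R \<Longrightarrow> S x \<in> carrier R"
  using ring_hom_closed[OF S] by simp

private lemma S_mult: "x \<in> carrier R \<Longrightarrow> y \<in> carrier R \<Longrightarrow> S (x \<otimes> y) = S y \<otimes> S x"
  using ring_hom_mult[OF S] by simp

private lemma S_add_hom: "S \<in> hom (add_monoid R) (add_monoid R)"
  using ring_hom_in_hom(2)[OF S] unfolding add_monoid_opposite_ring .

interpretation RR: two_rings R R
  by (intro two_rings.intro ring_axioms)

interpretation T: ring T
  by (rule RR.ring_tensor_ring)

lemma conv_add_hom:
  "conv_left S \<in> hom (add_monoid T) (add_monoid R)" "conv_right S \<in> hom (add_monoid T) (add_monoid R)"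
  and conv_pure:
  "a \<in> carrier R \<Longrightarrow> b \<in> carrier R \<Longrightarrow> conv_left S (pure_tensor R R a b) = S a \<otimes> b"
  "a \<in> carrier R \<Longrightarrow> b \<in> carrier R \<Longrightarrow> conv_right S (pure_tensor R R a b) = a \<otimes> S b"
proof -
  note id = ring_hom_in_hom(2)[OF ident_ring_hom, of R]
  note l = tensor_map_add_hom[OF ring_axioms ring_axioms ring_axioms ring_axioms S_add_hom id]
  note r = tensor_map_add_hom[OF ring_axioms ring_axioms ring_axioms ring_axioms id S_add_hom]
  show "conv_left S \<in> hom (add_monoid T) (add_monoid R)"
    using hom_compose[OF l(1) tensor_mult_add_hom(1)] by (simp add: conv_left_def comp_def)
  show "conv_right S \<in> hom (add_monoid T) (add_monoid R)"
    using hom_compose[OF r(1) tensor_mult_add_hom(1)] by (simp add: conv_right_def comp_def)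
  show "conv_left S (pure_tensor R R a b) = S a \<otimes> b" if "a \<in> carrier R" "b \<in> carrier R"
    using that by (simp add: conv_left_def l(2) tensor_mult_add_hom(2) S_closed)
  show "conv_right S (pure_tensor R R a b) = a \<otimes> S b" if "a \<in> carrier R" "b \<in> carrier R"
    using that by (simp add: conv_right_def r(2) tensor_mult_add_hom(2) S_closed)
qed

lemmas conv_simps = conv_pure S_closed S_mult RR.pure_mult
  add_hom_closed[OF conv_add_hom(1)] add_hom_add[OF conv_add_hom(1)]
  add_hom_closed[OF conv_add_hom(2)] add_hom_add[OF conv_add_hom(2)]

text \<open>Since \<open>S\<close> reverses products, \<open>S (a c) b d = S c (S a b) d\<close>; a scalar in the middle can be pulled out.\<close>

lemma conv_left_mult:
  assumes X: "X \<in> carrier T" and Y: "Y \<in> carrier T" and k: "conv_left S X = [(k :: int)] \<cdot> \<one>"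
  shows "conv_left S (X \<otimes>\<^bsub>T\<^esub> Y) = [k] \<cdot> conv_left S Y"
  using Y
proof (induction rule: RR.tensor_induct)
  case (pure c d)
  from X have "conv_left S (X \<otimes>\<^bsub>T\<^esub> pure_tensor R R c d) = S c \<otimes> conv_left S X \<otimes> d"
    by (induction rule: RR.tensor_induct)
      (simp_all add: pure conv_simps m_assoc T.l_distr l_distr r_distr)
  then show ?case
    using pure by (simp add: k conv_simps add_pow_ldistr_int add_pow_rdistr_int)
qed (use X in \<open>simp add: conv_simps T.r_distr add.int_pow_distrib\<close>)

text \<open>Here a c S(b d) = a (c S(d)) S(b), so the scalar has to come from the right factor
  \<open>Y\<close>.\<close>

lemma conv_right_mult:
  assumes X: "X \<in> carrier T" and Y: "Y \<in> carrier T" and k: "conv_right S Y = [(k :: int)] \<cdot> \<one>"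
  shows "conv_right S (X \<otimes>\<^bsub>T\<^esub> Y) = [k] \<cdot> conv_right S X"
  using X
proof (induction rule: RR.tensor_induct)
  case (pure a b)
  from Y have "conv_right S (pure_tensor R R a b \<otimes>\<^bsub>T\<^esub> Y) = a \<otimes> conv_right S Y \<otimes> S b"
    by (induction rule: RR.tensor_induct)
      (simp_all add: pure conv_simps m_assoc T.r_distr l_distr r_distr)
  then show ?case
    using pure by (simp add: k conv_simps add_pow_ldistr_int add_pow_rdistr_int)
qed (use Y in \<open>simp add: conv_simps T.l_distr add.int_pow_distrib\<close>)

text \<open>The elements satisfying both laws form a subring. For sums this is additivity; in a
  product, \<epsilon>(x) is pulled out of the left law and \<epsilon>(y) out of the right one,
  leaving the law for the other factor.\<close>

lemma antipode_generate_ring: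
  assumes \<Delta>: "\<Delta> \<in> ring_hom R T" and \<epsilon>: "\<epsilon> \<in> ring_hom R \<Z>" and X: "X \<subseteq> carrier R"
    and l: "\<And>x. x \<in> X \<Longrightarrow> conv_left S (\<Delta> x) = [\<epsilon> x] \<cdot> \<one>"
    and r: "\<And>x. x \<in> X \<Longrightarrow> conv_right S (\<Delta> x) = [\<epsilon> x] \<cdot> \<one>"
    and x: "x \<in> generate_ring R X"
  shows "conv_left S (\<Delta> x) = [\<epsilon> x] \<cdot> \<one> \<and> conv_right S (\<Delta> x) = [\<epsilon> x] \<cdot> \<one>"
proof -
  note [simp] = generate_ring_in_carrier[OF X] ring_hom_closed[OF \<Delta>]
    ring_hom_add[OF \<Delta>] ring_hom_mult[OF \<Delta>] ring_hom_add[OF \<epsilon>] ring_hom_mult[OF \<epsilon>]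
    add_hom_a_inv[OF is_abelian_group T.is_abelian_group ring_hom_in_hom(2)[OF \<Delta>]]
    add_hom_a_inv[OF is_abelian_group int.is_abelian_group ring_hom_in_hom(2)[OF \<epsilon>]]
    add_hom_a_inv[OF T.is_abelian_group is_abelian_group conv_add_hom(1)]
    add_hom_a_inv[OF T.is_abelian_group is_abelian_group conv_add_hom(2)]
  have S1: "S \<one> = \<one>" using ring_hom_one[OF S] by simp
  from x show ?thesis
  proof induction
    case one
    show ?case
      by (simp add: ring_hom_one[OF \<Delta>] ring_hom_one[OF \<epsilon>] RR.one_tensor_ring conv_simps S1)
  next
    case (eng_mult x y)
    then show ?case
      by (simp add: conv_left_mult[of _ _ "\<epsilon> x"] conv_right_mult[of _ _ "\<epsilon> y"] add.int_pow_pow mult.commute)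
  qed (simp_all add: l r conv_simps add.int_pow_neg add.int_pow_mult int_a_inv_eq)
qed

end

lemma int_hopf_algebraI_generators:
  assumes \<Delta>: "\<Delta> \<in> ring_hom R (tensor_ring R R)" and \<epsilon>: "\<epsilon> \<in> ring_hom R \<Z>"
    and S: "S \<in> ring_hom R (opposite_ring R)" and X: "carrier R = generate_ring R X"
    and coassoc: "\<And>x. x \<in> X \<Longrightarrow>
      tensor_assoc R R R (tensor_map (tensor_ring R R) R \<Delta> (\<lambda>y. y) (\<Delta> x)) =
      tensor_map R (tensor_ring R R) (\<lambda>y. y) \<Delta> (\<Delta> x)"
    and counit_left: "\<And>x. x \<in> X \<Longrightarrow> tensor_lunit R (tensor_map \<Z> R \<epsilon> (\<lambda>y. y) (\<Delta> x)) = x"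
    and counit_right: "\<And>x. x \<in> X \<Longrightarrow> tensor_runit R (tensor_map R \<Z> (\<lambda>y. y) \<epsilon> (\<Delta> x)) = x"
    and antipode_left: "\<And>x. x \<in> X \<Longrightarrow>
      tensor_mult R (tensor_map R R S (\<lambda>y. y) (\<Delta> x)) = [\<epsilon> x] \<cdot> \<one>"
    and antipode_right: "\<And>x. x \<in> X \<Longrightarrow>
      tensor_mult R (tensor_map R R (\<lambda>y. y) S (\<Delta> x)) = [\<epsilon> x] \<cdot> \<one>"
  shows "int_hopf_algebra R \<Delta> \<epsilon> S"
proof
  let ?T = "tensor_ring R R"
  interpret RR: two_rings R R by (intro two_rings.intro ring_axioms)
  interpret R_T: two_rings R ?T by (intro two_rings.intro ring_axioms RR.ring_tensor_ring)
  have XR: "X \<subseteq> carrier R"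
    unfolding X by (auto intro: generate_ring.incl)
  note R = ring_axioms and T = RR.ring_tensor_ring
  note eq = ring_hom_eq_on_generate_ring[OF R _ _ _ XR, folded X]
  note trans = ring_hom_trans[unfolded comp_def]
  show "\<Delta> \<in> ring_hom R ?T" "\<epsilon> \<in> ring_hom R \<Z>" by fact+
  show "S \<in> hom (add_monoid R) (add_monoid R)"
    using ring_hom_in_hom(2)[OF S] unfolding add_monoid_opposite_ring .
  fix x assume x: "x \<in> carrier R"
  show "tensor_assoc R R R (tensor_map ?T R \<Delta> (\<lambda>y. y) (\<Delta> x)) = tensor_map R ?T (\<lambda>y. y) \<Delta> (\<Delta> x)"
  proof (rule eq[OF R_T.ring_tensor_ring _ _ coassoc x])
    show "(\<lambda>x. tensor_assoc R R R (tensor_map ?T R \<Delta> (\<lambda>y. y) (\<Delta> x))) \<in> ring_hom R R_T.T"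
      by (intro trans[OF _ tensor_assoc_ring_hom(1)] trans[OF \<Delta> tensor_map_ring_hom]
          R T \<Delta> ident_ring_hom)
    show "(\<lambda>x. tensor_map R ?T (\<lambda>y. y) \<Delta> (\<Delta> x)) \<in> ring_hom R R_T.T"
      by (intro trans[OF \<Delta> tensor_map_ring_hom] R T \<Delta> ident_ring_hom)
  qed
  show "tensor_lunit R (tensor_map \<Z> R \<epsilon> (\<lambda>y. y) (\<Delta> x)) = x"
  proof (rule eq[OF R _ ident_ring_hom counit_left x])
    show "(\<lambda>x. tensor_lunit R (tensor_map \<Z> R \<epsilon> (\<lambda>y. y) (\<Delta> x))) \<in> ring_hom R R"
      by (intro trans[OF _ tensor_lunit_ring_hom(1)] trans[OF \<Delta> tensor_map_ring_hom]
          R ring_int_ring \<epsilon> ident_ring_hom)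
  qed
  show "tensor_runit R (tensor_map R \<Z> (\<lambda>y. y) \<epsilon> (\<Delta> x)) = x"
  proof (rule eq[OF R _ ident_ring_hom counit_right x])
    show "(\<lambda>x. tensor_runit R (tensor_map R \<Z> (\<lambda>y. y) \<epsilon> (\<Delta> x))) \<in> ring_hom R R"
      by (intro trans[OF _ tensor_runit_ring_hom(1)] trans[OF \<Delta> tensor_map_ring_hom]
          R ring_int_ring \<epsilon> ident_ring_hom)
  qed
  have *: "conv_left S (\<Delta> x) = [\<epsilon> x] \<cdot> \<one> \<and> conv_right S (\<Delta> x) = [\<epsilon> x] \<cdot> \<one>"
  proof (rule antipode_generate_ring[OF S \<Delta> \<epsilon> XR])
    show "x \<in> generate_ring R X" using x X by simp
  qed (simp_all add: conv_left_def conv_right_def antipode_left antipode_right)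
  then show "tensor_mult R (tensor_map R R S (\<lambda>y. y) (\<Delta> x)) = [\<epsilon> x] \<cdot> \<one>"
    "tensor_mult R (tensor_map R R (\<lambda>y. y) S (\<Delta> x)) = [\<epsilon> x] \<cdot> \<one>"
    by (simp_all add: conv_left_def conv_right_def)
qed

end

text \<open>In a right-associated product the left side x y of a commutation rule is no longer a
  subterm; this form still applies there.\<close>

lemma (in monoid) m_assoc_subst:
  assumes "x \<otimes> y = u \<otimes> v" "x \<in> carrier G" "y \<in> carrier G" "u \<in> carrier G" "v \<in> carrier G" "z \<in> carrier G"
  shows "x \<otimes> (y \<otimes> z) = u \<otimes> (v \<otimes> z)"
  using assms m_assoc[of x y z] m_assoc[of u v z] by simp

section \<open>Relations for the coproduct, counit and antipode\<close>

context hecke_hopf_family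
begin

lemma s_s: "i \<in> {1..n-1} \<Longrightarrow> s i \<otimes> s i = \<one>"
  and sD_Ds: "i \<in> {1..n-1} \<Longrightarrow> s i \<otimes> D i \<oplus> D i \<otimes> s i = s i \<ominus> \<one>"
  and D_D: "i \<in> {1..n-1} \<Longrightarrow> D i \<otimes> D i = D i"
  by (rule rel, erule hecke_hopf_rel.intros)+

lemma
  assumes "i \<in> {1..n-1}" "j \<in> {1..n-1}" "\<bar>int i - int j\<bar> > 1"
  shows ss_far: "s j \<otimes> s i = s i \<otimes> s j"
    and Ds_far: "D j \<otimes> s i = s i \<otimes> D j"
    and DD_far: "D j \<otimes> D i = D i \<otimes> D j"
  using assms by (auto intro!: rel intro: hecke_hopf_rel.intros)

lemma
  assumes "i \<in> {1..n-1}" "j \<in> {1..n-1}" "\<bar>int i - int j\<bar> = 1"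
  shows sss_braid: "s j \<otimes> s i \<otimes> s j = s i \<otimes> s j \<otimes> s i"
    and Dss_braid: "D i \<otimes> s j \<otimes> s i = s j \<otimes> s i \<otimes> D j"
    and DsD_braid: "D j \<otimes> s i \<otimes> D j = s i \<otimes> D j \<otimes> D i \<oplus> D i \<otimes> D j \<otimes> s i \<oplus> s i \<otimes> D j \<otimes> s i"
  using assms by (auto intro!: rel intro: hecke_hopf_rel.intros)

text \<open>Solved for s_i, the mixed relation can split a tensor leg in the D_j s_i D_j case
  below.\<close>

lemma s_eq: "i \<in> {1..n-1} \<Longrightarrow> s i = s i \<otimes> D i \<oplus> D i \<otimes> s i \<oplus> \<one>"
  by (simp add: sD_Ds a_minus_def a_assoc l_neg)

definition coproduct_s :: "nat \<Rightarrow> ('a \<times> 'a \<Rightarrow>\<^sub>0 int) set" where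
  "coproduct_s i = pure_tensor R R (s i) (s i)"

definition coproduct_D :: "nat \<Rightarrow> ('a \<times> 'a \<Rightarrow>\<^sub>0 int) set" where
  "coproduct_D i = pure_tensor R R (D i) \<one> \<oplus>\<^bsub>tensor_ring R R\<^esub> pure_tensor R R (s i) (D i)"

lemma coproduct_family: "hecke_hopf_family (tensor_ring R R) coproduct_s coproduct_D n"
proof -
  interpret RR: two_rings R R by (intro two_rings.intro ring_axioms)
  interpret T: ring "tensor_ring R R" by (rule RR.ring_tensor_ring)
  note defs = coproduct_s_def coproduct_D_def
  note expand = defs T.l_distr T.r_distr RR.pure_mult
  let ?T = "RR.T" and ?p = "RR.pure"
  show ?thesis
  proof
    fix l r assume "hecke_hopf_rel ?T coproduct_s coproduct_D n l r"
    then show "l = r"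
    proof cases
      case (s_sq i)
      then show ?thesis by (simp add: expand s_s RR.one_tensor_ring)
    next
      case (s_D i)
      let ?s = "s i" and ?a = "D i"
      \<comment> \<open>Since s s = 1, the sum s D + D s appears once in each leg. Replacing it by s
        - 1 gives (s - 1) \<otimes> s + 1 \<otimes> (s - 1), where the terms 1 \<otimes> s
        cancel.\<close>
      have "l = (?p (?s \<otimes> ?a) ?s \<oplus>\<^bsub>?T\<^esub> ?p (?a \<otimes> ?s) ?s) \<oplus>\<^bsub>?T\<^esub> (?p \<one> (?s \<otimes> ?a) \<oplus>\<^bsub>?T\<^esub> ?p \<one> (?a \<otimes> ?s))"
        using s_D by (simp add: expand s_s T.a_ac)
      also have "\<dots> = ?p (?s \<otimes> ?a \<oplus> ?a \<otimes> ?s) ?s \<oplus>\<^bsub>?T\<^esub> ?p \<one> (?s \<otimes> ?a \<oplus> ?a \<otimes> ?s)"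
        using s_D by (simp add: RR.pure_add_left RR.pure_add_right)
      also have "\<dots> = ?p ?s ?s \<oplus>\<^bsub>?T\<^esub> (\<ominus>\<^bsub>?T\<^esub> ?p \<one> ?s \<oplus>\<^bsub>?T\<^esub> (?p \<one> ?s \<oplus>\<^bsub>?T\<^esub> \<ominus>\<^bsub>?T\<^esub> ?p \<one> \<one>))"
        using s_D by (simp add: sD_Ds a_minus_def RR.pure_add_left RR.pure_add_right
            RR.pure_minus_left RR.pure_minus_right T.a_assoc)
      also have "\<dots> = r"
        using s_D by (simp add: defs RR.one_tensor_ring a_minus_def T.r_neg2 T.r_neg1)
      finally show ?thesis .
    next
      case (D_sq i)
      let ?s = "s i" and ?a = "D i"
      \<comment> \<open>The cross terms combine to (s D + D s) \<otimes> D = (s - 1) \<otimes> D;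
        its part -1 \<otimes> D cancels the last term, which comes from s s = 1 and D D = D.\<close>
      have "l = ?p ?a \<one> \<oplus>\<^bsub>?T\<^esub> ?p (?s \<otimes> ?a \<oplus> ?a \<otimes> ?s) ?a \<oplus>\<^bsub>?T\<^esub> ?p \<one> ?a"
        using D_sq by (simp add: expand s_s D_D RR.pure_add_left T.a_ac)
      also have "\<dots> = ?p ?a \<one> \<oplus>\<^bsub>?T\<^esub> (?p ?s ?a \<oplus>\<^bsub>?T\<^esub> (\<ominus>\<^bsub>?T\<^esub> ?p \<one> ?a \<oplus>\<^bsub>?T\<^esub> ?p \<one> ?a))"
        using D_sq by (simp add: sD_Ds a_minus_def RR.pure_add_left RR.pure_minus_left T.a_assoc)
      also have "\<dots> = r"
        using D_sq by (simp add: defs T.l_neg)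
      finally show ?thesis .
    next
      case (far_ss i j)
      then show ?thesis by (simp add: expand ss_far[of i j])
    next
      case (far_Ds i j)
      then show ?thesis by (simp add: expand Ds_far[of i j] ss_far[of i j])
    next
      case (far_DD i j)
      then show ?thesis
        by (simp add: expand Ds_far[of i j] Ds_far[of j i] ss_far[of i j]
            DD_far[of i j] T.a_ac)
    next
      case (braid_sss i j)
      then show ?thesis by (simp add: expand sss_braid[of i j])
    next
      case (braid_Dss i j)
      then show ?thesis by (simp add: expand Dss_braid[of i j] sss_braid[of i j])
    next
      case (braid_DsD i j)
      let ?s = "s i" and ?t = "s j" and ?a = "D i" and ?b = "D j"
      note [simp] = s_closed[OF \<open>i \<in> {1..n-1}\<close>] s_closed[OF \<open>j \<in> {1..n-1}\<close>]
        D_closed[OF \<open>i \<in> {1..n-1}\<close>] D_closed[OF \<open>j \<in> {1..n-1}\<close>]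
      have bst: "?b \<otimes> ?s \<otimes> ?t = ?s \<otimes> ?t \<otimes> ?a" and tsb: "?t \<otimes> ?s \<otimes> ?b = ?a \<otimes> ?t \<otimes> ?s"
        and tst: "?t \<otimes> ?s \<otimes> ?t = ?s \<otimes> ?t \<otimes> ?s"
        and bsb: "?b \<otimes> ?s \<otimes> ?b = ?s \<otimes> ?b \<otimes> ?a \<oplus> ?a \<otimes> ?b \<otimes> ?s \<oplus> ?s \<otimes> ?b \<otimes> ?s"
        using braid_DsD Dss_braid[of j i] Dss_braid[of i j] sss_braid[of i j]
          DsD_braid[of i j] by (auto simp: abs_minus_commute)
      \<comment> \<open>The only terms of the two sides that do not match directly: the left side
        has sbs \<otimes> s, the right side has sbs \<otimes> sa, sbs \<otimes> as and sbs \<otimes>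
        ss. They agree because s = sa + as + 1 and ss = 1.\<close>
      have "?p (?s \<otimes> ?b \<otimes> ?s) ?s = ?p (?s \<otimes> ?b \<otimes> ?s) (?s \<otimes> ?a \<oplus> ?a \<otimes> ?s \<oplus> \<one>)"
        using s_eq[of i] braid_DsD by simp
      also have "\<dots> = ?p (?s \<otimes> ?b \<otimes> ?s) (?s \<otimes> ?a) \<oplus>\<^bsub>?T\<^esub> ?p (?s \<otimes> ?b \<otimes> ?s) (?a \<otimes> ?s)
          \<oplus>\<^bsub>?T\<^esub> ?p (?s \<otimes> ?b \<otimes> ?s) \<one>"
        by (simp add: RR.pure_add_right)
      finally have split: "?p (?s \<otimes> ?b \<otimes> ?s) ?s = \<dots>" .
      have "l = ?p (?b \<otimes> ?s \<otimes> ?b) ?s \<oplus>\<^bsub>?T\<^esub> ?p (?b \<otimes> ?s \<otimes> ?t) (?s \<otimes> ?b)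
          \<oplus>\<^bsub>?T\<^esub> ?p (?t \<otimes> ?s \<otimes> ?b) (?b \<otimes> ?s) \<oplus>\<^bsub>?T\<^esub> ?p (?t \<otimes> ?s \<otimes> ?t) (?b \<otimes> ?s \<otimes> ?b)"
        unfolding braid_DsD by (simp add: expand T.a_ac)
      also have "\<dots> = ?p (?s \<otimes> ?b \<otimes> ?a) ?s \<oplus>\<^bsub>?T\<^esub> ?p (?a \<otimes> ?b \<otimes> ?s) ?s \<oplus>\<^bsub>?T\<^esub>
          (?p (?s \<otimes> ?b \<otimes> ?s) (?s \<otimes> ?a) \<oplus>\<^bsub>?T\<^esub> ?p (?s \<otimes> ?b \<otimes> ?s) (?a \<otimes> ?s) \<oplus>\<^bsub>?T\<^esub> ?p (?s \<otimes> ?b \<otimes> ?s) \<one>)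
          \<oplus>\<^bsub>?T\<^esub> ?p (?s \<otimes> ?t \<otimes> ?a) (?s \<otimes> ?b) \<oplus>\<^bsub>?T\<^esub> ?p (?a \<otimes> ?t \<otimes> ?s) (?b \<otimes> ?s)
          \<oplus>\<^bsub>?T\<^esub> ?p (?s \<otimes> ?t \<otimes> ?s) (?s \<otimes> ?b \<otimes> ?a) \<oplus>\<^bsub>?T\<^esub> ?p (?s \<otimes> ?t \<otimes> ?s) (?a \<otimes> ?b \<otimes> ?s)
          \<oplus>\<^bsub>?T\<^esub> ?p (?s \<otimes> ?t \<otimes> ?s) (?s \<otimes> ?b \<otimes> ?s)"
        unfolding bst tsb tst bsb by (simp add: RR.pure_add_left RR.pure_add_right split T.a_ac)
      also have "\<dots> = r"
        unfolding braid_DsD(2) using s_s[of i] braid_DsD by (simp add: expand T.a_ac)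
      finally show ?thesis .
    qed
  qed (simp_all add: defs)
qed

lemma counit_family: "hecke_hopf_family \<Z> (\<lambda>_. 1) (\<lambda>_. 0) n"
proof
  fix l r assume "hecke_hopf_rel \<Z> (\<lambda>_. 1) (\<lambda>_. 0) n l r"
  then show "l = r"
    by cases (simp_all add: int_a_minus_eq)
qed simp_all

text \<open>Multiply s D + D s = s - 1 by s on the right. The formula yields both the idempotence of
  -s_i D_i and the square of the antipode.\<close>

lemma sDs: "i \<in> {1..n-1} \<Longrightarrow> s i \<otimes> D i \<otimes> s i = \<one> \<ominus> s i \<ominus> D i"
proof -
  assume i: "i \<in> {1..n-1}"
  then have "(s i \<otimes> D i \<oplus> D i \<otimes> s i) \<otimes> s i = \<one> \<ominus> s i"
    by (simp add: sD_Ds a_minus_def l_distr l_minus s_s)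
  then have "s i \<otimes> D i \<otimes> s i \<oplus> D i = \<one> \<ominus> s i"
    using i by (simp add: l_distr m_assoc s_s)
  then show ?thesis
    using i by (metis (no_types, lifting) D_closed a_minus_def add.inv_solve_right m_closed minus_closed one_closed s_closed)
qed

end

section \<open>Relations for the antipode\<close>

context hecke_hopf_family
begin

definition antipode_D :: "nat \<Rightarrow> 'a" where
  "antipode_D i = \<ominus> (s i \<otimes> D i)"

lemma Ds: "i \<in> {1..n-1} \<Longrightarrow> D i \<otimes> s i = s i \<ominus> \<one> \<ominus> s i \<otimes> D i"
proof -
  assume i: "i \<in> {1..n-1}"
  then have "D i \<otimes> s i = (s i \<otimes> D i \<oplus> D i \<otimes> s i) \<ominus> s i \<otimes> D i"
    by (simp add: a_minus_def a_ac r_neg r_neg1)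
  then show ?thesis using i by (simp add: sD_Ds)
qed

lemma s_s_left: "i \<in> {1..n-1} \<Longrightarrow> x \<in> carrier R \<Longrightarrow> s i \<otimes> (s i \<otimes> x) = x"
  by (simp add: m_assoc[symmetric] s_s)

text \<open>This is the D_j s_i D_j relation for -s_i D_i and -s_j D_j with all factors reversed.
  Signs cancel in pairs except in the last term, which contains a single such factor.\<close>

lemma antipode_DsD:
  assumes i: "i \<in> {1..n-1}" and j: "j \<in> {1..n-1}" and ij: "\<bar>int i - int j\<bar> = 1"
  shows "s j \<otimes> D j \<otimes> s i \<otimes> s j \<otimes> D j =
    s i \<otimes> D i \<otimes> s j \<otimes> D j \<otimes> s i \<oplus> s i \<otimes> s j \<otimes> D j \<otimes> s i \<otimes> D i \<ominus> s i \<otimes> s j \<otimes> D j \<otimes> s i"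
    (is "?L = ?R")
proof -
  let ?s = "s i" and ?t = "s j" and ?a = "D i" and ?b = "D j"
  note [simp] = s_closed[OF i] s_closed[OF j] D_closed[OF i] D_closed[OF j]
  have bst: "?b \<otimes> ?s \<otimes> ?t = ?s \<otimes> ?t \<otimes> ?a" and ats: "?a \<otimes> ?t \<otimes> ?s = ?t \<otimes> ?s \<otimes> ?b"
    and tst: "?t \<otimes> ?s \<otimes> ?t = ?s \<otimes> ?t \<otimes> ?s"
    and bsb: "?b \<otimes> ?s \<otimes> ?b = ?s \<otimes> ?b \<otimes> ?a \<oplus> ?a \<otimes> ?b \<otimes> ?s \<oplus> ?s \<otimes> ?b \<otimes> ?s"
    using i j ij Dss_braid[of j i] Dss_braid[of i j] sss_braid[of i j] DsD_braid[of i j]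
    by (auto simp: abs_minus_commute)
  \<comment> \<open>Each term is \<open>w\<close> times a shorter word, with \<open>w\<close> on the
    left. What remains to be shown is ab = bsbs + sbsa - sbs, a rearrangement of
    \<open>key\<close>.\<close>
  define w where "w = ?s \<otimes> ?t \<otimes> ?s"
  have [simp]: "w \<in> carrier R" by (simp add: w_def)
  have "?b \<otimes> ?s \<otimes> ?b \<otimes> ?s = ?s \<otimes> ?b \<otimes> (?a \<otimes> ?s) \<oplus> ?a \<otimes> ?b \<oplus> ?s \<otimes> ?b"
    unfolding bsb using i by (simp add: l_distr m_assoc s_s)
  \<comment> \<open>Moving s to the left past a produces -sb, which cancels the sb left over from
    sbs times s.\<close>
  also have "\<dots> = ?s \<otimes> ?b \<otimes> ?s \<ominus> ?s \<otimes> ?b \<ominus> ?s \<otimes> ?b \<otimes> ?s \<otimes> ?a \<oplus> ?a \<otimes> ?b \<oplus> ?s \<otimes> ?b"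
    using i by (simp add: Ds a_minus_def r_distr r_minus m_assoc)
  also have "\<dots> = ?a \<otimes> ?b \<oplus> ?s \<otimes> ?b \<otimes> ?s \<ominus> ?s \<otimes> ?b \<otimes> ?s \<otimes> ?a"
    by (simp add: a_minus_def a_ac r_neg1 r_neg2)
  finally have key: "?b \<otimes> ?s \<otimes> ?b \<otimes> ?s = \<dots>" .
  have at: "?a \<otimes> ?t = ?t \<otimes> ?s \<otimes> ?b \<otimes> ?s"
    unfolding ats[symmetric] using i by (simp add: m_assoc s_s)
  have "?L = ?t \<otimes> (?b \<otimes> ?s \<otimes> ?t) \<otimes> ?b"
    by (simp add: m_assoc)
  also have "\<dots> = (?t \<otimes> ?s \<otimes> ?t) \<otimes> (?a \<otimes> ?b)"
    unfolding bst by (simp add: m_assoc)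
  finally have L: "?L = w \<otimes> (?a \<otimes> ?b)"
    by (simp add: tst w_def)
  have "?s \<otimes> ?a \<otimes> ?t \<otimes> ?b \<otimes> ?s = ?s \<otimes> (?a \<otimes> ?t) \<otimes> ?b \<otimes> ?s"
    by (simp add: m_assoc)
  also have "\<dots> = w \<otimes> (?b \<otimes> ?s \<otimes> ?b \<otimes> ?s)"
    unfolding at w_def by (simp add: m_assoc)
  finally have R1: "?s \<otimes> ?a \<otimes> ?t \<otimes> ?b \<otimes> ?s = w \<otimes> (?b \<otimes> ?s \<otimes> ?b \<otimes> ?s)" .
  \<comment> \<open>Inserting s s = 1 after st exposes \<open>w\<close>.\<close>
  have R2: "?s \<otimes> ?t \<otimes> ?b \<otimes> ?s \<otimes> ?a = w \<otimes> (?s \<otimes> ?b \<otimes> ?s \<otimes> ?a)"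
    and R3: "?s \<otimes> ?t \<otimes> ?b \<otimes> ?s = w \<otimes> (?s \<otimes> ?b \<otimes> ?s)"
    using i by (simp_all add: w_def m_assoc s_s_left)
  have "?R = w \<otimes> (?a \<otimes> ?b \<oplus> ?s \<otimes> ?b \<otimes> ?s \<ominus> ?s \<otimes> ?b \<otimes> ?s \<otimes> ?a) \<oplus>
      w \<otimes> (?s \<otimes> ?b \<otimes> ?s \<otimes> ?a) \<ominus> w \<otimes> (?s \<otimes> ?b \<otimes> ?s)"
    \<comment> \<open>\<open>R3\<close> is applied last because its left side is a subterm of the
      left side of \<open>R2\<close>.\<close>
    unfolding R1 R2 key unfolding R3 ..
  also have "\<dots> = w \<otimes> (?a \<otimes> ?b)"
    by (simp add: a_minus_def r_distr r_minus a_ac r_neg1 r_neg2 r_neg)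
  finally show ?thesis by (simp add: L)
qed

lemma antipode_family: "hecke_hopf_family (opposite_ring R) s antipode_D n"
proof (intro hecke_hopf_family.intro hecke_hopf_family_axioms.intro ring_opposite_ring)
  fix l r assume "hecke_hopf_rel (opposite_ring R) s antipode_D n l r"
  then show "l = r"
  proof cases
    case (s_sq i)
    then show ?thesis by (simp add: s_s)
  next
    case (s_D i)
    \<comment> \<open>The two products are -s D s and -D; by \<open>sDs\<close> they add up to s -
      1.\<close>
    have "antipode_D i \<otimes> s i = \<ominus> (s i \<otimes> D i \<otimes> s i)" "s i \<otimes> antipode_D i = \<ominus> D i"
      using s_D by (simp_all add: antipode_D_def l_minus r_minus s_s_left)
    moreover have "D i \<oplus> (s i \<oplus> (\<ominus> D i \<oplus> \<ominus> \<one>)) = s i \<oplus> \<ominus> \<one>"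
      using s_D by (simp add: a_lcomm[of "D i" "s i"] r_neg1 r_neg2)
    ultimately show ?thesis
      using s_D by (simp add: sDs a_minus_def minus_add a_ac)
  next
    case (D_sq i)
    \<comment> \<open>Here (s D s) D = (1 - s - D) D, which D D = D reduces to -s D.\<close>
    have "antipode_D i \<otimes> antipode_D i = s i \<otimes> D i \<otimes> s i \<otimes> D i"
      using D_sq by (simp add: antipode_D_def l_minus r_minus m_assoc)
    also have "\<dots> = antipode_D i"
      using D_sq by (simp add: sDs a_minus_def l_distr l_minus D_D antipode_D_def a_ac r_neg1 r_neg2 r_neg)
    finally show ?thesis using D_sq by simp
  next
    case (far_ss i j)
    then show ?thesis by (simp add: ss_far[of i j])
  next
    case (far_Ds i j)
    have c: "s i \<in> carrier R" "s j \<in> carrier R" "D j \<in> carrier R"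
      using far_Ds by simp_all
    note comm = ss_far[OF far_Ds(3-5)] Ds_far[OF far_Ds(3-5)]
    show ?thesis
      using far_Ds(1,2) c
      by (simp add: antipode_D_def l_minus r_minus m_assoc comm m_assoc_subst[OF comm(1)])
  next
    case (far_DD i j)
    have c: "s i \<in> carrier R" "s j \<in> carrier R" "D i \<in> carrier R" "D j \<in> carrier R"
      using far_DD by simp_all
    have ji: "\<bar>int j - int i\<bar> > 1" using far_DD by simp
    note comm = ss_far[OF far_DD(3-5)] Ds_far[OF far_DD(3-5)] Ds_far[OF far_DD(4,3) ji] DD_far[OF far_DD(3-5)]
    show ?thesis
      using far_DD(1,2) c
      by (simp add: antipode_D_def l_minus r_minus m_assoc comm m_assoc_subst[OF comm(1)]
          m_assoc_subst[OF comm(2)] m_assoc_subst[OF comm(3)])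
  next
    case (braid_sss i j)
    then show ?thesis using sss_braid[of i j] by (simp add: m_assoc)
  next
    case (braid_Dss i j)
    have c: "s i \<in> carrier R" "s j \<in> carrier R" "D i \<in> carrier R" "D j \<in> carrier R"
      using braid_Dss by simp_all
    have ji: "\<bar>int j - int i\<bar> = 1" using braid_Dss by simp
    \<comment> \<open>After reversal the sides are -s_i s_j s_i D_i and -s_j D_j s_i s_j. The
      relation with i and j exchanged carries D_j to the far right as D_i, and the braid relation
      finishes.\<close>
    have "r = \<ominus> (s j \<otimes> (D j \<otimes> s i \<otimes> s j))"
      unfolding braid_Dss(2) using c by (simp add: antipode_D_def l_minus m_assoc)
    also have "\<dots> = \<ominus> (s j \<otimes> s i \<otimes> s j \<otimes> D i)"
      using c by (simp add: Dss_braid[OF braid_Dss(4,3) ji] m_assoc)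
    also have "\<dots> = l"
      unfolding braid_Dss(1) sss_braid[OF braid_Dss(3-5)]
      using c by (simp add: antipode_D_def r_minus m_assoc)
    finally show ?thesis by simp
  next
    case (braid_DsD i j)
    have c: "s i \<in> carrier R" "s j \<in> carrier R" "D i \<in> carrier R" "D j \<in> carrier R"
      using braid_DsD by simp_all
    have "l = s j \<otimes> D j \<otimes> s i \<otimes> s j \<otimes> D j"
      unfolding braid_DsD(1) using c by (simp add: antipode_D_def l_minus r_minus m_assoc)
    also have "\<dots> = r"
      unfolding antipode_DsD[OF braid_DsD(3-5)] braid_DsD(2)
      using c by (simp add: antipode_D_def l_minus r_minus m_assoc a_minus_def)
    finally show ?thesis .
  qed
qed (simp_all add: antipode_D_def)

section \<open>Axioms on the generators, and bijectivity of the antipode\<close>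

context
  fixes \<Delta> :: "'a \<Rightarrow> ('a \<times> 'a \<Rightarrow>\<^sub>0 int) set" and \<epsilon> :: "'a \<Rightarrow> int" and S :: "'a \<Rightarrow> 'a"
  assumes gen: "carrier R = generate_ring R (s ` {1..n-1} \<union> D ` {1..n-1})"
    and \<Delta>: "\<Delta> \<in> ring_hom R (tensor_ring R R)"
      "\<And>i. i \<in> {1..n-1} \<Longrightarrow> \<Delta> (s i) = coproduct_s i"
      "\<And>i. i \<in> {1..n-1} \<Longrightarrow> \<Delta> (D i) = coproduct_D i"
    and \<epsilon>: "\<epsilon> \<in> ring_hom R \<Z>"
      "\<And>i. i \<in> {1..n-1} \<Longrightarrow> \<epsilon> (s i) = 1"
      "\<And>i. i \<in> {1..n-1} \<Longrightarrow> \<epsilon> (D i) = 0"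
    and S: "S \<in> ring_hom R (opposite_ring R)"
      "\<And>i. i \<in> {1..n-1} \<Longrightarrow> S (s i) = s i"
      "\<And>i. i \<in> {1..n-1} \<Longrightarrow> S (D i) = antipode_D i"
begin

lemma int_hopf_algebra_hecke_hopf_family: "int_hopf_algebra R \<Delta> \<epsilon> S"
proof (rule int_hopf_algebraI_generators[OF \<Delta>(1) \<epsilon>(1) S(1) gen])
  let ?T = "tensor_ring R R"
  interpret RR: two_rings R R by (intro two_rings.intro ring_axioms)
  interpret R_T: two_rings R ?T by (intro two_rings.intro ring_axioms RR.ring_tensor_ring)
  interpret T_R: two_rings ?T R by (intro two_rings.intro ring_axioms RR.ring_tensor_ring)
  interpret ZR: two_rings \<Z> R by (intro two_rings.intro ring_axioms ring_int_ring)
  interpret RZ: two_rings R \<Z> by (intro two_rings.intro ring_axioms ring_int_ring)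
  interpret TTT: ring R_T.T by (rule R_T.ring_tensor_ring)
  interpret TTT': ring T_R.T by (rule T_R.ring_tensor_ring)
  note R = ring_axioms and T = RR.ring_tensor_ring and Z = ring_int_ring
  note id = ring_hom_in_hom(2)[OF ident_ring_hom]
  note \<Delta>_add = ring_hom_in_hom(2)[OF \<Delta>(1)] and \<epsilon>_add = ring_hom_in_hom(2)[OF \<epsilon>(1)]
  have S_add: "S \<in> hom (add_monoid R) (add_monoid R)"
    using ring_hom_in_hom(2)[OF S(1)] unfolding add_monoid_opposite_ring .
  have S1: "S \<one> = \<one>" using ring_hom_one[OF S(1)] by simp
  note defs = \<Delta>(2,3) coproduct_s_def coproduct_D_def
  fix x assume "x \<in> s ` {1..n-1} \<union> D ` {1..n-1}"
  then consider i where "i \<in> {1..n-1}" "x = s i" | i where "i \<in> {1..n-1}" "x = D i" by auto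
  note gen_cases = this
  note maps = tensor_map_add_hom[OF R R T R \<Delta>_add id] tensor_map_add_hom[OF R R R T id \<Delta>_add]
  note assoc = tensor_assoc_ring_hom[OF R R R]
  \<comment> \<open>On D_i both sides equal D_i \<otimes> (1 \<otimes> 1) + s_i \<otimes> (D_i
    \<otimes> 1) + s_i \<otimes> (s_i \<otimes> D_i), the first term because \<Delta>(1) = 1
    \<otimes> 1.\<close>
  from gen_cases show "tensor_assoc R R R (tensor_map ?T R \<Delta> (\<lambda>y. y) (\<Delta> x)) =
      tensor_map R ?T (\<lambda>y. y) \<Delta> (\<Delta> x)"
    by cases (simp_all add: defs maps(2,4) add_hom_add[OF maps(1)] add_hom_add[OF maps(3)] assoc(2)
        ring_hom_add[OF assoc(1)] ring_hom_closed[OF assoc(1)] ring_hom_one[OF \<Delta>(1)]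
        RR.one_tensor_ring T_R.pure_add_left R_T.pure_add_right TTT.a_assoc)
  note maps = tensor_map_add_hom[OF R R Z R \<epsilon>_add id] tensor_map_add_hom[OF R R R Z id \<epsilon>_add]
  from gen_cases show "tensor_lunit R (tensor_map \<Z> R \<epsilon> (\<lambda>y. y) (\<Delta> x)) = x"
    by cases (simp_all add: defs \<epsilon> add_pow_int_zero maps(2) add_hom_add[OF maps(1)] tensor_lunit_ring_hom(2)
        ring_hom_add[OF tensor_lunit_ring_hom(1)])
  from gen_cases show "tensor_runit R (tensor_map R \<Z> (\<lambda>y. y) \<epsilon> (\<Delta> x)) = x"
    by cases (simp_all add: defs \<epsilon> add_pow_int_zero ring_hom_one[OF \<epsilon>(1)] maps(4) add_hom_add[OF maps(3)]
        tensor_runit_ring_hom(2) ring_hom_add[OF tensor_runit_ring_hom(1)])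
  \<comment> \<open>On D_i the left law reads -s_i D_i + s_i D_i = 0 and the right law D_i - s_i s_i
    D_i = 0.\<close>
  from gen_cases show "tensor_mult R (tensor_map R R S (\<lambda>y. y) (\<Delta> x)) = [\<epsilon> x] \<cdot> \<one>"
    unfolding fun_cong[OF conv_left_def, symmetric]
    by cases (simp_all add: defs \<epsilon> add_pow_int_zero conv_simps[OF S(1)] S(2,3) s_s antipode_D_def l_neg)
  from gen_cases show "tensor_mult R (tensor_map R R (\<lambda>y. y) S (\<Delta> x)) = [\<epsilon> x] \<cdot> \<one>"
    unfolding fun_cong[OF conv_right_def, symmetric]
    by cases (simp_all add: defs \<epsilon> add_pow_int_zero conv_simps[OF S(1)] S(2,3) S1 s_s antipode_D_def r_minus s_s_left r_neg)
qed

text \<open>\<open>S\<^sup>4 = id\<close> because \<open>S\<^sup>2\<close> fixes \<open>s i\<close> and maps \<open>D i\<close> to \<open>s i D i s i = 1 - s i - D i\<close>.\<close>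

lemma ring_anti_automorphism_hecke_hopf_family: "ring_anti_automorphism R S"
proof -
  have SS: "S (S x) \<in> carrier R" "S x \<in> carrier R" if "x \<in> carrier R" for x
    using that ring_hom_closed[OF S(1)] by simp_all
  \<comment> \<open>Reversing products twice restores them, so S also maps the opposite ring back to
    the ring and S o S is an ordinary ring homomorphism, determined by its values on the
    generators.\<close>
  have S_op: "S \<in> ring_hom (opposite_ring R) R"
    using S(1) by (auto simp: ring_hom_def)
  have sq: "(\<lambda>x. S (S x)) \<in> ring_hom R R"
    using ring_hom_trans[OF S(1) S_op] by (simp add: comp_def)
  have hom: "(\<lambda>x. S (S (S (S x)))) \<in> ring_hom R R"
    using ring_hom_trans[OF sq sq] by (simp add: comp_def)
  note add = ring_hom_in_hom(2)[OF sq]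
  have sq_D: "S (S (D i)) = \<one> \<ominus> s i \<ominus> D i" if i: "i \<in> {1..n-1}" for i
  proof -
    have "S (S (D i)) = \<ominus> (S (s i \<otimes> D i))"
      using i add_hom_a_inv[OF is_abelian_group is_abelian_group, of S "s i \<otimes> D i"]
        ring_hom_in_hom(2)[OF S(1)]
      unfolding add_monoid_opposite_ring by (simp add: S antipode_D_def)
    also have "S (s i \<otimes> D i) = \<ominus> (s i \<otimes> D i \<otimes> s i)"
      using i ring_hom_mult[OF S(1), of "s i" "D i"] by (simp add: S antipode_D_def l_minus)
    finally show ?thesis using i by (simp add: sDs)
  qed
  have "S (S (S (S x))) = x" if "x \<in> s ` {1..n-1} \<union> D ` {1..n-1}" for x
  proof -
    consider i where "i \<in> {1..n-1}" "x = s i" | i where "i \<in> {1..n-1}" "x = D i"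
      using \<open>x \<in> _\<close> by auto
    then show ?thesis
    proof cases
      case 1
      then show ?thesis by (simp add: S)
    next
      case 2
      \<comment> \<open>S o S fixes 1 and s_i, so it acts on D_i as the reflection x \<mapsto> 1 -
        s_i - x, which is an involution.\<close>
      have "S (S (\<one> \<ominus> s i \<ominus> D i)) = \<one> \<ominus> s i \<ominus> (\<one> \<ominus> s i \<ominus> D i)"
        using 2 ring_hom_one[OF sq] sq_D
          add_hom_minus[OF is_abelian_group is_abelian_group add]
        by (simp add: S)
      also have "\<dots> = D i"
        using 2 by (simp add: a_minus_def minus_add a_ac r_neg1 r_neg2 r_neg)
      finally show ?thesis using 2 sq_D by simp
    qed
  qed
  then have id: "S (S (S (S x))) = x" if "x \<in> carrier R" for x
    using ring_hom_eq_on_generate_ring[OF ring_axioms ring_axioms hom ident_ring_hom, of _ x] that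
      gen generate_ring.incl[of _ "s ` {1..n-1} \<union> D ` {1..n-1}" R] by blast
  \<comment> \<open>The inverse is the threefold iterate of S.\<close>
  have "bij_betw S (carrier R) (carrier R)"
    by (rule bij_betw_byWitness[of _ "\<lambda>x. S (S (S x))"]) (auto simp: id SS)
  then show ?thesis
    using S(1) by (simp add: ring_anti_automorphism_def ring_iso_def)
qed

end

end

theorem theorem1p3:
  fixes n :: nat
  assumes "n \<ge> 2"
  shows "\<exists>\<Delta> \<epsilon> S.
    int_hopf_algebra (hecke_hopf n) \<Delta> \<epsilon> S \<and>
    ring_anti_automorphism (hecke_hopf n) S \<and>
    (\<forall>i\<in>{1..n-1}.
      \<Delta> (hh_s n i) = pure_tensor (hecke_hopf n) (hecke_hopf n) (hh_s n i) (hh_s n i) \<and>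
      \<Delta> (hh_D n i) =
        pure_tensor (hecke_hopf n) (hecke_hopf n) (hh_D n i) \<one>\<^bsub>hecke_hopf n\<^esub>
          \<oplus>\<^bsub>tensor_ring (hecke_hopf n) (hecke_hopf n)\<^esub>
        pure_tensor (hecke_hopf n) (hecke_hopf n) (hh_s n i) (hh_D n i) \<and>
      \<epsilon> (hh_s n i) = 1 \<and>
      \<epsilon> (hh_D n i) = 0 \<and>
      S (hh_s n i) = hh_s n i \<and>
      S (hh_D n i) = \<ominus>\<^bsub>hecke_hopf n\<^esub> (hh_s n i \<otimes>\<^bsub>hecke_hopf n\<^esub> hh_D n i))"
proof -
  interpret H: hecke_hopf_family "hecke_hopf n" "hh_s n" "hh_D n" n
    by (rule hecke_hopf_family_hecke_hopf)
  obtain \<Delta> where \<Delta>: "\<Delta> \<in> ring_hom (hecke_hopf n) (tensor_ring (hecke_hopf n) (hecke_hopf n))"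
    "\<And>i. i \<in> {1..n-1} \<Longrightarrow> \<Delta> (hh_s n i) = H.coproduct_s i"
    "\<And>i. i \<in> {1..n-1} \<Longrightarrow> \<Delta> (hh_D n i) = H.coproduct_D i"
    by (rule hecke_hopf_universal[OF H.coproduct_family]) (use that in blast)
  obtain \<epsilon> where \<epsilon>: "\<epsilon> \<in> ring_hom (hecke_hopf n) \<Z>"
    "\<And>i. i \<in> {1..n-1} \<Longrightarrow> \<epsilon> (hh_s n i) = 1" "\<And>i. i \<in> {1..n-1} \<Longrightarrow> \<epsilon> (hh_D n i) = 0"
    by (rule hecke_hopf_universal[OF H.counit_family]) (use that in blast)
  obtain S where S: "S \<in> ring_hom (hecke_hopf n) (opposite_ring (hecke_hopf n))"
    "\<And>i. i \<in> {1..n-1} \<Longrightarrow> S (hh_s n i) = hh_s n i"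
    "\<And>i. i \<in> {1..n-1} \<Longrightarrow> S (hh_D n i) = H.antipode_D i"
    by (rule hecke_hopf_universal[OF H.antipode_family]) (use that in blast)
  note hyps = hecke_hopf_generated \<Delta> \<epsilon> S
  show ?thesis
    using H.int_hopf_algebra_hecke_hopf_family[OF hyps] H.ring_anti_automorphism_hecke_hopf_family[OF hyps]
      \<Delta>(2,3) \<epsilon>(2,3) S(2,3)
    unfolding H.coproduct_s_def H.coproduct_D_def H.antipode_D_def by blast
qed

end
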